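(* Let $S\in\mathbb{S}^d_m$ and let $\nu$ be a Borel probability measure on $\mathbb{R}^d$ with finite second moment. For any $\gamma\in\Gamma(\nu)$ and $G\in\mathcal{M}(S)$ the following are equivalent: (a) $\gamma$ is an optimal plan (a maximizer of $\frac12\int S(x,y)\,d\gamma$ over $\Gamma(\nu)$) and $G$ is an optimal set (a minimizer of $\int\psi_G\,d\nu$ over $\mathcal{M}(S)$); (b) $x\in P_G(y)$ for all $(x,y)\in\operatorname{supp}\gamma$; (c) $x\in P_G(x)\subset P_G(y)$ for $\gamma$-almost every $(x,y)$.
   Context: $\mathbb{S}^d_m$ is the set of symmetric invertible $d\times d$ real matrices with exactly $m$ positive eigenvalues; $S(x,y):=\langle x,Sy\rangle$. A set $G\subset\mathbb{R}^d$ is $S$-monotone if $S(x-y,x-y)\ge0$ for all $x,y\in G$; it is maximal $S$-monotone if it is not a strict subset of another $S$-monotone set; $\mathcal{M}(S)$ denotes the family of maximal $S$-monotone sets. For $G\subset\mathbb{R}^d$, $\psi_G(y):=\sup_{x\in G}\big(S(x,y)-\tfrac12S(x,x)\big)$ and $P_G(y):=\operatorname{argmax}_{x\in G}\big(S(x,y)-\tfrac12S(x,x)\big)$ (equivalently $\operatorname{argmin}_{x\in G}S(x-y,x-y)$), $y\in\mathbb{R}^d$. $\Gamma(\nu)$ is the set of Borel probability measures $\gamma$ on $\mathbb{R}^d\times\mathbb{R}^d$ (coordinates $(x,y)$) with finite second moments, second marginal $\nu$, and such that the $\gamma$-conditional expectation of $y$ given $x$ equals $x$. *)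

theory Defs
  imports "HOL-Probability.Probability" "HOL-Computational_Algebra.Polynomial"
begin

definition Sform :: "real^'n^'n \<Rightarrow> real^'n \<Rightarrow> real^'n \<Rightarrow> real" where
  "Sform S x y = x \<bullet> (S *v y)"

definition charpoly_vec :: "real^'n^'n \<Rightarrow> real poly" where
  "charpoly_vec A = det (\<chi> i j. (if i = j then [:0, 1:] else 0) - [:A $ i $ j:])"

definition pos_eig_count :: "real^'n^'n \<Rightarrow> nat" where
  "pos_eig_count A =
     (\<Sum>r\<in>{x::real. 0 < x \<and> poly (charpoly_vec A) x = 0}. order r (charpoly_vec A))"

definition Sdm :: "nat \<Rightarrow> (real^'n^'n) set" where
  "Sdm m = {S. transpose S = S \<and> invertible S \<and> pos_eig_count S = m}"

definition S_monotone :: "real^'n^'n \<Rightarrow> (real^'n) set \<Rightarrow> bool" where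
  "S_monotone S G \<longleftrightarrow> (\<forall>x\<in>G. \<forall>y\<in>G. Sform S (x - y) (x - y) \<ge> 0)"

definition maxS_monotone :: "real^'n^'n \<Rightarrow> (real^'n) set set" where
  "maxS_monotone S = {G. S_monotone S G \<and> (\<forall>H. S_monotone S H \<and> G \<subseteq> H \<longrightarrow> H = G)}"

definition psiG :: "real^'n^'n \<Rightarrow> (real^'n) set \<Rightarrow> real^'n \<Rightarrow> ereal" where
  "psiG S G y = (SUP x\<in>G. ereal (Sform S x y - Sform S x x / 2))"

definition PG :: "real^'n^'n \<Rightarrow> (real^'n) set \<Rightarrow> real^'n \<Rightarrow> (real^'n) set" where
  "PG S G y = {x\<in>G. \<forall>x'\<in>G. Sform S x' y - Sform S x' x' / 2 \<le> Sform S x y - Sform S x x / 2}"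

(* extended Lebesgue integral  int f^+ - int f^-  of an ereal-valued function *)
definition ext_integral :: "'a measure \<Rightarrow> ('a \<Rightarrow> ereal) \<Rightarrow> ereal" where
  "ext_integral M f =
     enn2ereal (\<integral>\<^sup>+ x. e2ennreal (f x) \<partial>M) - enn2ereal (\<integral>\<^sup>+ x. e2ennreal (- f x) \<partial>M)"

definition msupp :: "'a::topological_space measure \<Rightarrow> 'a set" where
  "msupp M = {p. \<forall>U. open U \<and> p \<in> U \<longrightarrow> emeasure M U > 0}"

definition Gamma :: "(real^'n) measure \<Rightarrow> ((real^'n) \<times> (real^'n)) measure set" where
  "Gamma \<nu> = {\<gamma>. prob_space \<gamma> \<and> sets \<gamma> = sets borel
      \<and> integrable \<gamma> (\<lambda>p. norm p ^ 2)
      \<and> distr \<gamma> borel snd = \<nu>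
      \<and> (\<forall>i. AE p in \<gamma>.
            real_cond_exp \<gamma> (vimage_algebra (space \<gamma>) fst borel) (\<lambda>q. snd q $ i) p = fst p $ i)}"

definition plan_value :: "real^'n^'n \<Rightarrow> ((real^'n) \<times> (real^'n)) measure \<Rightarrow> real" where
  "plan_value S \<gamma> = (\<integral>p. Sform S (fst p) (snd p) \<partial>\<gamma>) / 2"

definition optimal_plan :: "real^'n^'n \<Rightarrow> (real^'n) measure \<Rightarrow> ((real^'n) \<times> (real^'n)) measure \<Rightarrow> bool" where
  "optimal_plan S \<nu> \<gamma> \<longleftrightarrow> \<gamma> \<in> Gamma \<nu> \<and> (\<forall>\<gamma>'\<in>Gamma \<nu>. plan_value S \<gamma>' \<le> plan_value S \<gamma>)"

definition optimal_set :: "real^'n^'n \<Rightarrow> (real^'n) measure \<Rightarrow> (real^'n) set \<Rightarrow> bool" where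
  "optimal_set S \<nu> G \<longleftrightarrow> G \<in> maxS_monotone S \<and>
     (\<forall>G'\<in>maxS_monotone S. ext_integral \<nu> (psiG S G) \<le> ext_integral \<nu> (psiG S G'))"

end

(*
Write q(x) = S(x,x)/2 and f(x,y) = S(x,y) - q(x), so that psi_G(y) is the supremum of f(x,y) over
x in G; a maximal S-monotone set G satisfies psi_G >= q, with equality exactly on G. The martingale
property gives E f(X,Y) = E q(X) for every plan, and this is the value of the plan; by Jensen,
E q(X) <= E psi_G(X) <= E psi_G(Y), which is weak duality. If x lies in P_G(y) on the support, both
inequalities are equalities, so plan and set are optimal.

For the converse there must be no duality gap. Perturbing an optimal plan shows that
q(E[w Y]) <= E[w f(X,Y)] for every bounded density w, i.e. the convex set of all pairs
(E[w Y], E[w f(X,Y)]) lies above the graph of q. A maximal convex set C above the graph of q touches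
it along a maximal S-monotone set G (the analogue of Fitzpatrick's theorem for monotone operators),
and f(x,z) <= r for x in G and (z,r) in C. Letting w concentrate at a point (x,y) of the support
yields psi_G(y) <= f(x,y) there, so that E psi_G(Y) is at most the value of the plan.

Finally, if X lies in P_G(Y) almost surely and x' is a measurable selection of P_G(X), then
f(x',Y) <= f(X,Y) while both sides have the same conditional mean q(X) given X; hence they agree
almost surely, and countably many approximate selections exhaust P_G(X).
*)

theory Submission
  imports Defs
begin

section \<open>Nondegenerate symmetric forms\<close>

text \<open>Since \<open>S\<close> may be indefinite, E q(X) has no sign and no convexity in X, sets
  in \<open>maxS_monotone S\<close> may be unbounded, and \<open>psiG\<close> may be infinite. Three
  devices answer this. Convexity is found in pairs (z, r) of means, since both coordinates depend
  linearly on the density. Coercivity comes from a fundamental symmetry J of the form, which plays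
  the part of the duality map in the surjectivity theorem for maximal monotone operators: it is what
  makes the touching set maximal and not just monotone. Integrals of \<open>psiG\<close> are only
  compared with those of integrable real functions, obtained from finite maxima along a dense
  sequence of G. The delicate point of the perturbation is that the new plan has to satisfy the
  martingale constraint exactly. The first coordinate is therefore moved by a quotient of
  conditional expectations; the first-order effect of this move on the value cancels, and its
  second-order effect is bounded uniformly in the size of the perturbation.\<close>

locale nondegenerate_form =
  fixes S :: "real^'n^'n"
  assumes symmetric: "transpose S = S" and nondegenerate: "invertible S"
begin

abbreviation B where "B \<equiv> Sform S"

definition quad :: "real^'n \<Rightarrow> real" where
  "quad x = B x x / 2"

definition minorant :: "real^'n \<Rightarrow> real^'n \<Rightarrow> real" where
  "minorant x y = B x y - quad x"

lemma B_add_left: "B (x + y) z = B x z + B y z"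
  and B_add_right: "B z (x + y) = B z x + B z y"
  and B_diff_left: "B (x - y) z = B x z - B y z"
  and B_diff_right: "B z (x - y) = B z x - B z y"
  and B_scale_left: "B (c *\<^sub>R x) z = c * B x z"
  and B_scale_right: "B z (c *\<^sub>R x) = c * B z x"
  and B_minus_left: "B (- x) z = - B x z"
  and B_minus_right: "B z (- x) = - B z x"
  and B_zero_left: "B 0 z = 0"
  and B_zero_right: "B z 0 = 0"
  by (simp_all add: Sform_def algebra_simps matrix_vector_mult_scaleR linear_neg[OF matrix_vector_mul_linear])

lemma B_commute: "B x y = B y x"
proof -
  have "B x y = (transpose S *v x) \<bullet> y"
    by (simp add: Sform_def transpose_matrix_vector dot_lmul_matrix)
  then show ?thesis by (simp add: symmetric Sform_def inner_commute)
qed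

lemmas B_simps = B_add_left B_add_right B_diff_left B_diff_right B_scale_left B_scale_right
  B_minus_left B_minus_right B_zero_left B_zero_right

lemma bounded_bilinear_B: "bounded_bilinear B"
  unfolding Sform_def
  by (intro bounded_bilinear.comp[OF bounded_bilinear_inner bounded_linear_ident matrix_vector_mul_bounded_linear])

lemma continuous_on_B [continuous_intros]:
  "continuous_on A u \<Longrightarrow> continuous_on A v \<Longrightarrow> continuous_on A (\<lambda>x. B (u x) (v x))"
  by (rule bounded_bilinear.continuous_on[OF bounded_bilinear_B])

lemma continuous_on_quad [continuous_intros]:
  "continuous_on A u \<Longrightarrow> continuous_on A (\<lambda>x. quad (u x))"
  unfolding quad_def by (intro continuous_intros) auto

lemma continuous_on_minorant [continuous_intros]:
  "continuous_on A u \<Longrightarrow> continuous_on A v \<Longrightarrow> continuous_on A (\<lambda>x. minorant (u x) (v x))"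
  unfolding minorant_def by (intro continuous_intros) auto

lemma B_bound: obtains C where "C > 0" "\<And>x y. \<bar>B x y\<bar> \<le> C * norm x * norm y"
  using bounded_bilinear.pos_bounded[OF bounded_bilinear_B]
  by (auto simp: mult.commute mult.left_commute mult.assoc)

text \<open>Completing the square: \<open>minorant x\<close> is the tangent of \<open>quad\<close>
  at x, and its gap at y is \<open>quad (x - y)\<close>. So x and y are monotonically related
  exactly when \<open>minorant x y\<close> is at most \<open>quad y\<close>, and an argmax of
  \<open>minorant\<close> in x is an argmin of S(x - y, x - y).\<close>

lemma minorant_eq: "minorant x y = quad y - quad (x - y)"
  by (simp add: minorant_def quad_def B_simps B_commute[of y x] field_simps)

lemma minorant_self [simp]: "minorant x x = quad x"
  by (simp add: minorant_def quad_def)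

lemma quad_minus: "quad (- x) = quad x"
  by (simp add: quad_def B_simps)

lemma quad_diff_commute: "quad (x - y) = quad (y - x)"
  using quad_minus[of "x - y"] by simp

section \<open>Nondegeneracy and fundamental symmetries\<close>

lemma B_eq_zeroD:
  assumes "\<And>y. B x y = 0" shows "x = 0"
proof -
  have "(S *v x) \<bullet> (S *v x) = 0"
    using assms[of "S *v x"] B_commute[of x] by (simp add: Sform_def)
  then have "S *v x = 0" by simp
  then show "x = 0"
    using nondegenerate by (simp add: invertible_left_inverse matrix_left_invertible_ker)
qed

text \<open>The notion known from Krein spaces: \<open>B (J x) y\<close> is an inner product whose
  norm is equivalent to the Euclidean one.\<close>

definition fundamental_symmetry :: "(real^'n \<Rightarrow> real^'n) \<Rightarrow> bool" where
  "fundamental_symmetry J \<longleftrightarrow> linear J \<and> (\<forall>x. J (J x) = x) \<and> (\<forall>x y. B (J x) y = B x (J y))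
     \<and> (\<exists>c>0. \<forall>x. c * norm x ^ 2 \<le> B (J x) x)"

text \<open>Split the space into a negative definite subspace N of largest dimension and its
  B-orthogonal complement P; J is the reflection that changes the sign on N. Nondegeneracy upgrades
  semidefiniteness on P to definiteness, and compactness of the unit sphere gives the constant
  c.\<close>

lemma fundamental_symmetry_exists: "\<exists>J. fundamental_symmetry J"
proof -
  define neg where "neg N \<longleftrightarrow> subspace N \<and> (\<forall>x\<in>N. x \<noteq> 0 \<longrightarrow> B x x < 0)" for N
  have "neg {0}" by (auto simp: neg_def)
  moreover have "\<And>N::(real^'n) set. dim N < Suc DIM(real^'n)"
    by (simp add: less_Suc_eq_le dim_subset_UNIV del: DIM_cart)
  ultimately obtain N where N: "neg N" and maxN: "\<And>M. neg M \<Longrightarrow> dim M \<le> dim N"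
    using ex_has_greatest_nat[of neg "{0}" dim "Suc DIM(real^'n)"] by blast
  define P where "P = {p. \<forall>n\<in>N. B n p = 0}"
  have subN: "subspace N" using N by (simp add: neg_def)
  have negN: "B x x < 0" if "x \<in> N" "x \<noteq> 0" for x using N that by (simp add: neg_def)
  have subP: "subspace P" by (auto simp: P_def subspace_def B_simps)
  have NP: "B n p = 0" "B p n = 0" if "n \<in> N" "p \<in> P" for n p
    using that B_commute by (auto simp: P_def)
  have int0: "x = 0" if "x \<in> N" "x \<in> P" for x
    using negN[of x] NP[of x x] that by fastforce
  \<comment> \<open>Adjoining to N a vector p of P with \<open>B p p < 0\<close> would give a larger
    negative definite subspace.\<close>
  have psd: "0 \<le> B p p" if p: "p \<in> P" for p
  proof (rule ccontr)
    assume "\<not> 0 \<le> B p p"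
    then have lt: "B p p < 0" by simp
    then have pN: "p \<notin> N" using int0[of p] p by (auto simp: B_simps)
    have "neg (span (insert p N))"
      unfolding neg_def
    proof (intro conjI ballI impI)
      fix x assume "x \<in> span (insert p N)" and x0: "x \<noteq> 0"
      then obtain k where "x - k *\<^sub>R p \<in> span N"
        by (auto simp: span_breakdown_eq)
      then have n: "x - k *\<^sub>R p \<in> N" using subN span_eq_iff by metis
      define n where "n = x - k *\<^sub>R p"
      have nN: "n \<in> N" using n by (simp add: n_def)
      have x: "x = n + k *\<^sub>R p" by (simp add: n_def)
      have e: "B x x = B n n + k^2 * B p p"
        using NP[OF nN p] by (simp add: x B_simps power2_eq_square)
      show "B x x < 0"
      proof (cases "n = 0")
        case True
        then have "k \<noteq> 0" using x0 x by auto
        then show ?thesis using e lt True by (simp add: B_simps mult_pos_neg)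
      next
        case False
        have "k^2 * B p p \<le> 0" using lt by (simp add: mult_nonneg_nonpos)
        then show ?thesis using e negN[OF nN False] by linarith
      qed
    qed (rule subspace_span)
    from maxN[OF this] have "dim (insert p N) \<le> dim N" by simp
    moreover have "p \<notin> span N" using pN subN span_eq_iff by metis
    ultimately show False by (simp add: dim_insert)
  qed
  have dimP: "dim P + dim N \<ge> DIM(real^'n)"
  proof -
    \<comment> \<open>P is the Euclidean orthogonal complement of the image of N under S, which
      yields its dimension.\<close>
    let ?A = "(\<lambda>x. S *v x) ` N"
    have "subspace ?A" using subN by (intro linear_subspace_image) auto
    from dim_subspace_orthogonal_to_vectors[OF this subspace_UNIV]
    have "dim {y \<in> UNIV. \<forall>x\<in>?A. orthogonal x y} + dim ?A = DIM(real^'n)" by simp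
    moreover have "{y \<in> UNIV. \<forall>x\<in>?A. orthogonal x y} = P"
      using B_commute by (auto simp: P_def orthogonal_def Sform_def inner_commute)
    ultimately have "dim P + dim ?A = DIM(real^'n)" by (simp only:)
    moreover have "dim ?A \<le> dim N" by (intro dim_image_le) auto
    then have "dim P + dim ?A \<le> dim P + dim N" by (rule add_left_mono)
    ultimately show ?thesis by (simp only:)
  qed
 have "N \<inter> P \<subseteq> {0}" using int0 by auto
  then have "dim (N \<inter> P) = 0" by (simp only: dim_eq_0)
  then have dimge: "DIM(real^'n) \<le> dim {x + y |x y. x \<in> N \<and> y \<in> P}"
    using dim_sums_Int[OF subN subP] dimP by presburger
  then have sumUNIV: "{x + y |x y. x \<in> N \<and> y \<in> P} = UNIV"
  proof -
    let ?W = "{x + y |x y. x \<in> N \<and> y \<in> P}"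
    have "dim ?W = DIM(real^'n)"
      using dimge dim_subset_UNIV[of ?W] by (rule antisym[rotated])
    then have "span ?W = UNIV" by (simp only: dim_eq_full)
    moreover have "span ?W = ?W" using subspace_sums[OF subN subP] by (simp only: span_eq_iff)
    ultimately show ?thesis by (simp only:)
  qed
  have "\<exists>n\<in>N. x - n \<in> P" for x
  proof -
    have "x \<in> {x + y |x y. x \<in> N \<and> y \<in> P}" using sumUNIV by simp
    then show ?thesis by force
  qed
  then obtain \<pi> where piN: "\<And>x. \<pi> x \<in> N" and piP: "\<And>x. x - \<pi> x \<in> P" by metis
  have uniq: "\<pi> x = n" if "n \<in> N" "x - n \<in> P" for x n
  proof -
    have "\<pi> x - n \<in> N" using subN piN that by (auto intro: subspace_diff)
    moreover have "(x - n) - (x - \<pi> x) \<in> P" by (intro subspace_diff subP piP that)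
    ultimately show ?thesis using int0[of "\<pi> x - n"] by simp
  qed
  have lin: "linear \<pi>"
  proof
    fix x y c
    have "(x - \<pi> x) + (y - \<pi> y) \<in> P" by (intro subspace_add subP piP)
    then show "\<pi> (x + y) = \<pi> x + \<pi> y"
      using subN piN by (intro uniq) (auto intro: subspace_add simp: algebra_simps)
    have "c *\<^sub>R (x - \<pi> x) \<in> P" by (intro subspace_scale subP piP)
    then show "\<pi> (c *\<^sub>R x) = c *\<^sub>R \<pi> x"
      using subN piN by (intro uniq) (auto intro: subspace_scale simp: algebra_simps)
  qed
  define J where "J x = x - 2 *\<^sub>R \<pi> x" for x
  have linJ: "linear J" unfolding J_def
    by (intro linear_compose_sub linear_compose_scale_right lin linear_ident)
  have invJ: "J (J x) = x" for x
  proof -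
    have "\<pi> (J x) = - \<pi> x"
    proof (rule uniq)
      show "- \<pi> x \<in> N" using subN piN by (simp add: subspace_neg)
      show "J x - - \<pi> x \<in> P" using piP[of x] by (simp add: J_def scaleR_2)
    qed
    then show ?thesis by (simp add: J_def[of "J x"]) (simp add: J_def)
  qed
  have BJ: "B (J x) y = B (x - \<pi> x) (y - \<pi> y) - B (\<pi> x) (\<pi> y)"
      "B x (J y) = B (x - \<pi> x) (y - \<pi> y) - B (\<pi> x) (\<pi> y)" for x y
    using NP[OF piN[of x] piP[of y]] NP[OF piN[of y] piP[of x]]
    by (simp_all add: J_def B_simps)
  have pd: "B (J x) x > 0" if "x \<noteq> 0" for x
  proof (cases "\<pi> x = 0")
    case False
    then show ?thesis using BJ(1)[of x x] psd[OF piP[of x]] negN[OF piN[of x]] by simp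
  next
    case True
    then have xP: "x \<in> P" using piP[of x] by simp
    have "B x x \<noteq> 0"
    proof
      assume z: "B x x = 0"
      have BP: "B x p = 0" if p: "p \<in> P" for p
      proof (rule ccontr)
        assume nz: "B x p \<noteq> 0"
        \<comment> \<open>With this t the quadratic form at \<open>p + t *\<^sub>R x\<close> equals
          -1. An isotropic vector of the semidefinite form on P is therefore orthogonal to P, and
          being orthogonal to N as well it vanishes.\<close>
        define t where "t = - (B p p + 1) / (2 * B x p)"
        have "p + t *\<^sub>R x \<in> P" using subP xP p by (auto intro: subspace_add subspace_scale)
        from psd[OF this] have "0 \<le> B p p + 2 * t * B x p"
          using z by (simp add: B_simps B_commute[of p x])
        then show False using nz by (simp add: t_def field_simps)
      qed
      have "B x y = 0" for y
        using BP[OF piP[of y]] NP[OF piN[of y] xP] by (simp add: B_simps)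
      then show False using B_eq_zeroD that by blast
    qed
    then show ?thesis using BJ(1)[of x x] psd[OF xP] True by (simp add: B_simps)
  qed
  have "continuous_on (sphere 0 1) (\<lambda>x. B (J x) x)"
    using linJ by (intro continuous_intros linear_continuous_on linear_conv_bounded_linear[THEN iffD1])
  then obtain z where z: "z \<in> sphere 0 1" and zmin: "\<And>x. x \<in> sphere 0 1 \<Longrightarrow> B (J z) z \<le> B (J x) x"
    using continuous_attains_inf[of "sphere (0::real^'n) 1" "\<lambda>x. B (J x) x"] by auto
  have "B (J z) z > 0" using z by (intro pd) auto
  moreover have "B (J z) z * norm x ^ 2 \<le> B (J x) x" for x
  proof (cases "x = 0")
    case False
    let ?u = "(1 / norm x) *\<^sub>R x"
    have Ju: "J ?u = (1 / norm x) *\<^sub>R J x" using linJ by (simp add: linear_cmul)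
    have "B (J z) z \<le> B (J ?u) ?u" using False by (intro zmin) auto
    then show ?thesis unfolding Ju using False by (simp add: B_simps field_simps power2_eq_square)
  qed (use linJ in \<open>simp add: linear_0 B_simps\<close>)
  ultimately have "\<exists>c>0. \<forall>x. c * norm x ^ 2 \<le> B (J x) x" by blast
  moreover have "B (J x) y = B x (J y)" for x y by (simp only: BJ)
  ultimately show ?thesis using linJ invJ unfolding fundamental_symmetry_def by blast
qed

section \<open>Maximal monotone sets and convex sets above a quadratic form\<close>

lemma S_monotone_iff: "S_monotone S G \<longleftrightarrow> (\<forall>x\<in>G. \<forall>y\<in>G. 0 \<le> quad (x - y))"
  by (simp add: S_monotone_def quad_def)

text \<open>A point monotonically related to all of G can be adjoined to G, so maximality already
  puts it there. This pointwise test replaces quantification over larger sets from here on.\<close>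

lemma mem_maxS_monotone_iff:
  assumes "G \<in> maxS_monotone S"
  shows "x \<in> G \<longleftrightarrow> (\<forall>y\<in>G. 0 \<le> quad (x - y))"
proof
  assume r: "\<forall>y\<in>G. 0 \<le> quad (x - y)"
  have mono: "S_monotone S G" and max: "\<And>H. S_monotone S H \<Longrightarrow> G \<subseteq> H \<Longrightarrow> H = G"
    using assms by (auto simp: maxS_monotone_def)
  have "S_monotone S (insert x G)"
    using mono r quad_diff_commute by (auto simp: S_monotone_iff quad_def B_simps)
  then show "x \<in> G" using max by blast
qed (use assms in \<open>auto simp: maxS_monotone_def S_monotone_iff\<close>)

lemma maxS_monotone_nonempty: "G \<in> maxS_monotone S \<Longrightarrow> G \<noteq> {}"
  using mem_maxS_monotone_iff by blast

lemma closed_maxS_monotone: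
  assumes "G \<in> maxS_monotone S" shows "closed G"
proof -
  have "G = (\<Inter>y\<in>G. {x. 0 \<le> quad (x - y)})"
    using mem_maxS_monotone_iff[OF assms] by blast
  moreover have "closed {x. 0 \<le> quad (x - y)}" for y
    by (intro closed_Collect_le continuous_intros)
  ultimately show ?thesis by (metis closed_INT)
qed

section \<open>Maximal convex sets above the graph of the quadratic form\<close>

definition above_quad :: "((real^'n) \<times> real) set \<Rightarrow> bool" where
  "above_quad C \<longleftrightarrow> convex C \<and> (\<forall>p\<in>C. quad (fst p) \<le> snd p)"

text \<open>Such sets stand in for epigraphs of the representative functions of monotone operator
  theory. Sets ordered by inclusion suit Zorn's lemma and convex hulls, and infinite function values
  never enter.\<close>

definition maximal_above_quad :: "((real^'n) \<times> real) set \<Rightarrow> bool" where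
  "maximal_above_quad C \<longleftrightarrow> above_quad C \<and> C \<noteq> {} \<and> (\<forall>D. above_quad D \<and> C \<subseteq> D \<longrightarrow> D = C)"

lemma maximal_above_quad_exists:
  assumes "above_quad C0" "C0 \<noteq> {}"
  obtains C where "maximal_above_quad C" "C0 \<subseteq> C"
proof -
  let ?A = "{C. above_quad C \<and> C0 \<subseteq> C}"
  have "\<exists>M\<in>?A. \<forall>X\<in>?A. M \<subseteq> X \<longrightarrow> X = M"
  proof (rule subset_Zorn_nonempty)
    show "?A \<noteq> {}" using assms by auto
    fix \<C> assume ne: "\<C> \<noteq> {}" and ch: "subset.chain ?A \<C>"
    have sub: "\<C> \<subseteq> ?A" using ch unfolding subset_chain_def by (rule conjunct1)
    have cmp: "X \<subseteq> Y \<or> Y \<subseteq> X" if "X \<in> \<C>" "Y \<in> \<C>" for X Y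
      using ch that unfolding subset_chain_def by metis
    \<comment> \<open>Any two points of the union already lie in a common member of the
      chain.\<close>
    have "convex (\<Union>\<C>)"
    proof (rule convexI)
      fix x y u v :: "_" assume xy: "x \<in> \<Union>\<C>" "y \<in> \<Union>\<C>" and uv: "0 \<le> (u::real)" "0 \<le> v" "u + v = 1"
      then obtain X1 X2 where X12: "X1 \<in> \<C>" "x \<in> X1" "X2 \<in> \<C>" "y \<in> X2" by (elim UnionE)
      obtain X where X: "X \<in> \<C>" "x \<in> X" "y \<in> X"
        using cmp[OF X12(1) X12(3)] X12 that by (auto simp only: subset_iff)
      then have "convex X" using sub by (auto simp: above_quad_def)
      then have "u *\<^sub>R x + v *\<^sub>R y \<in> X" using X uv by (simp add: convexD)
      then show "u *\<^sub>R x + v *\<^sub>R y \<in> \<Union>\<C>" using X(1) by (rule UnionI[rotated])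
    qed
    moreover have "quad (fst p) \<le> snd p" if p: "p \<in> \<Union>\<C>" for p
    proof -
      obtain X where "X \<in> \<C>" "p \<in> X" using p by (elim UnionE)
      then have "above_quad X" using sub by blast
      then show ?thesis using \<open>p \<in> X\<close> unfolding above_quad_def by blast
    qed
    moreover have "C0 \<subseteq> \<Union>\<C>" using ne sub by blast
    ultimately show "\<Union>\<C> \<in> ?A" by (simp add: above_quad_def)
  qed
  then obtain C where CA: "C \<in> ?A" and max: "\<forall>X\<in>?A. C \<subseteq> X \<longrightarrow> X = C" by (elim bexE)
  have C: "above_quad C" "C0 \<subseteq> C" "\<And>X. above_quad X \<Longrightarrow> C0 \<subseteq> X \<Longrightarrow> C \<subseteq> X \<Longrightarrow> X = C"
    using CA max by simp_all
  have "C \<noteq> {}" using C(2) assms(2) by blast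
  moreover have "D = C" if "above_quad D" "C \<subseteq> D" for D
    using C(3)[OF that(1) order_trans[OF C(2) that(2)] that(2)] .
  ultimately have "maximal_above_quad C" using C(1) by (simp add: maximal_above_quad_def)
  then show ?thesis using C(2) that by blast
qed

lemma maximal_above_quad_closed:
  assumes "maximal_above_quad C" shows "closed C"
proof -
  have "above_quad (closure C)"
    unfolding above_quad_def
  proof
    show "convex (closure C)" using assms by (simp add: maximal_above_quad_def above_quad_def convex_closure)
    have "closure C \<subseteq> {p. quad (fst p) \<le> snd p}"
      using assms by (intro closure_minimal closed_Collect_le continuous_intros)
        (auto simp: maximal_above_quad_def above_quad_def)
    then show "\<forall>p\<in>closure C. quad (fst p) \<le> snd p" by auto
  qed
  moreover have max: "\<And>D. above_quad D \<Longrightarrow> C \<subseteq> D \<Longrightarrow> D = C"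
    using assms by (simp add: maximal_above_quad_def)
  ultimately have "closure C = C" using max[OF _ closure_subset] by simp
  then show ?thesis by (simp only: closure_eq)
qed

lemma quad_convex_combination:
  assumes "u + v = 1"
  shows "quad (u *\<^sub>R x + v *\<^sub>R y) = u * quad x + v * quad y - u * v * quad (x - y)"
proof -
  have v: "v = 1 - u" using assms by simp
  show ?thesis unfolding v quad_def by (simp add: B_simps B_commute[of y x] field_simps)
qed

text \<open>The tangent condition at w is just what keeps the convex hull of C and
  \<open>(w, quad w)\<close> above \<open>quad\<close>: on a segment to (z, r), \<open>quad\<close>
  is bounded using a convex combination of \<open>quad z\<close> and \<open>minorant w z\<close>,
  both at most r. Maximality then absorbs the new point.\<close>

lemma maximal_above_quad_mem:
  assumes C: "maximal_above_quad C" and le: "\<And>z r. (z, r) \<in> C \<Longrightarrow> minorant w z \<le> r"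
  shows "(w, quad w) \<in> C"
proof -
  have cC: "convex C" and ne: "C \<noteq> {}" and ab: "\<And>z r. (z, r) \<in> C \<Longrightarrow> quad z \<le> r"
    and max: "\<And>D. above_quad D \<Longrightarrow> C \<subseteq> D \<Longrightarrow> D = C"
    using C by (auto simp: maximal_above_quad_def above_quad_def)
  let ?D = "convex hull (insert (w, quad w) C)"
  have "above_quad ?D"
    unfolding above_quad_def
  proof (intro conjI ballI convex_convex_hull)
    fix p assume "p \<in> ?D"
    then obtain u v b where uv: "0 \<le> u" "0 \<le> v" "u + v = 1" and b: "b \<in> C"
      and p: "p = u *\<^sub>R (w, quad w) + v *\<^sub>R b"
      using convex_hull_insert[OF ne] cC by (auto simp: hull_same[of convex C])
    obtain z r where zr: "b = (z, r)" by (cases b)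
    have 1: "quad z \<le> r" and 2: "quad z - quad (w - z) \<le> r"
      using ab le b zr minorant_eq by auto
    have v: "v = 1 - u" using uv by simp
    have "quad (u *\<^sub>R w + v *\<^sub>R z) = u * quad w + v * quad z - u * v * quad (w - z)"
      by (rule quad_convex_combination[OF uv(3)])
    also have "\<dots> = u * quad w + v * ((1 - u) * quad z + u * (quad z - quad (w - z)))"
      by (simp add: algebra_simps)
    also have "\<dots> \<le> u * quad w + v * ((1 - u) * r + u * r)"
      using 1 2 uv by (intro add_left_mono mult_left_mono add_mono) auto
    also have "\<dots> = u * quad w + v * r" by (simp add: algebra_simps)
    finally show "quad (fst p) \<le> snd p" by (simp add: p zr)
  qed
  then have "?D = C" by (intro max) (auto intro: hull_inc)
  then show ?thesis by (metis hull_inc insertI1)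
qed

text \<open>The segment from (z, r) to the touching point stays above \<open>quad\<close>. Its slack
  carries a factor 1 - u; dividing by it and letting u tend to 1 leaves the tangent inequality at
  x.\<close>

lemma maximal_above_quad_le:
  assumes C: "maximal_above_quad C" and x: "(x, quad x) \<in> C" and z: "(z, r) \<in> C"
  shows "minorant x z \<le> r"
proof -
  have cC: "convex C" and ab: "\<And>z r. (z, r) \<in> C \<Longrightarrow> quad z \<le> r"
    using C by (auto simp: maximal_above_quad_def above_quad_def)
  have *: "quad z - u * quad (x - z) \<le> r" if u: "0 < u" "u < 1" for u
  proof -
    have "u *\<^sub>R (x, quad x) + (1 - u) *\<^sub>R (z, r) \<in> C"
      using u by (intro convexD[OF cC x z]) auto
    then have "quad (u *\<^sub>R x + (1 - u) *\<^sub>R z) \<le> u * quad x + (1 - u) * r" by (auto dest: ab)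
    then have "(1 - u) * (quad z - u * quad (x - z)) \<le> (1 - u) * r"
      by (simp add: quad_convex_combination) (simp add: algebra_simps)
    then show ?thesis using u by (simp add: mult_le_cancel_left)
  qed
  have "((\<lambda>u. quad z - u * quad (x - z)) \<longlongrightarrow> quad z - 1 * quad (x - z)) (at_left 1)"
    by (intro tendsto_intros)
  moreover have "eventually (\<lambda>u::real. 0 < u \<and> u < 1) (at_left 1)"
    using eventually_at_left_real[of 0 "1::real"] by (auto elim: eventually_mono)
  then have "eventually (\<lambda>u. quad z - u * quad (x - z) \<le> r) (at_left 1)"
    by (rule eventually_mono) (use * in auto)
  ultimately have "quad z - 1 * quad (x - z) \<le> r"
    by (intro tendsto_upperbound[of _ _ "at_left 1"]) auto
  then show ?thesis by (simp add: minorant_eq)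
qed

text \<open>Minimising \<open>r - minorant x0 z + B (J (z - x0)) (z - x0) / 2\<close> over \<open>(z, r) \<in> C\<close> is a
  strongly convex problem; its optimality condition exhibits a point of the graph of \<open>quad\<close>
  which is compatible with \<open>x0\<close> only if it is \<open>x0\<close> itself.\<close>

lemma maximal_above_quad_minimizer:
  assumes C: "maximal_above_quad C" and J: "fundamental_symmetry J"
  obtains z0 r0 where "(z0, r0) \<in> C"
    "\<And>z r. (z, r) \<in> C \<Longrightarrow> r0 + B (x0 - J (z0 - x0)) (z - z0) \<le> r"
proof -
  have cC: "convex C" and ne: "C \<noteq> {}" and ab: "\<And>p. p \<in> C \<Longrightarrow> quad (fst p) \<le> snd p"
    using C by (auto simp: maximal_above_quad_def above_quad_def)
  have clC: "closed C" by (rule maximal_above_quad_closed[OF C])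
  from J have lJ: "linear J" and JJ: "\<And>x. J (J x) = x" and sJ: "\<And>x y. B (J x) y = B x (J y)"
    by (auto simp: fundamental_symmetry_def)
  obtain c where c: "c > 0" "\<And>x. c * norm x ^ 2 \<le> B (J x) x"
    using J by (auto simp: fundamental_symmetry_def)
  have N0: "0 \<le> B (J x) x" for x
    using order_trans[OF mult_nonneg_nonneg[OF less_imp_le[OF c(1)] zero_le_power2] c(2)] .
  note lJs = linear_add[OF lJ] linear_diff[OF lJ] linear_cmul[OF lJ]
  define \<Phi> where "\<Phi> p = snd p - minorant x0 (fst p) + B (J (fst p - x0)) (fst p - x0) / 2" for p
  \<comment> \<open>With h = z - x0, the sum \<open>quad h + B (J h) h / 2\<close> is a quarter of
    the positive form at \<open>h + J h\<close>. So the added penalty compensates the negative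
    directions of \<open>quad\<close>.\<close>
  have Phi0: "0 \<le> \<Phi> p" if "p \<in> C" for p
  proof -
    define h where "h = fst p - x0"
    have "B (J (h + J h)) (h + J h) = 2 * (B h h + B (J h) h)"
      unfolding lJs JJ by (simp add: B_add_left B_add_right sJ[symmetric] JJ linear_add[OF lJ])
    then have "0 \<le> quad h + B (J h) h / 2" using N0[of "h + J h"] by (simp add: quad_def)
    then show ?thesis using ab[OF that] quad_diff_commute[of "fst p" x0]
      by (simp add: \<Phi>_def minorant_eq h_def)
  qed
  \<comment> \<open>Exact second-order expansion along a segment; the coefficient of
    \<open>t^2\<close> is coercive in the first coordinate only.\<close>
  have Phi_line: "\<Phi> (p + t *\<^sub>R (p' - p)) = \<Phi> p
      + t * (snd p' - snd p - B (x0 - J (fst p - x0)) (fst p' - fst p))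
      + t^2 * (B (J (fst p' - fst p)) (fst p' - fst p) / 2)" for p p' t
  proof -
    obtain z r z' r' where p: "p = (z, r)" "p' = (z', r')" by (cases p, cases p')
    let ?d = "z' - z" and ?h = "z - x0"
    have e: "z + t *\<^sub>R ?d - x0 = ?h + t *\<^sub>R ?d" by simp
    have s: "B (J ?d) ?h = B (J ?h) ?d" using sJ B_commute by metis
    have "B (J (?h + t *\<^sub>R ?d)) (?h + t *\<^sub>R ?d) = B (J ?h) ?h + 2 * t * B (J ?h) ?d + t^2 * B (J ?d) ?d"
      unfolding linear_add[OF lJ, of ?h] linear_cmul[OF lJ, of t ?d]
      by (simp only: B_add_left B_add_right B_scale_left B_scale_right s) (simp add: power2_eq_square distrib_left)
    then show ?thesis
      unfolding \<Phi>_def p fst_add snd_add fst_diff snd_diff fst_scaleR snd_scaleR fst_conv snd_conv e minorant_def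
      by (simp add: B_add_right B_diff_left B_scale_right) (simp add: field_simps)
  qed
  define m where "m = Inf (\<Phi> ` C)"
  have bdd: "bdd_below (\<Phi> ` C)" by (rule bdd_belowI2[of _ 0]) (rule Phi0)
  have m_le: "m \<le> \<Phi> p" if "p \<in> C" for p unfolding m_def by (rule cINF_lower[OF bdd that])
  define \<epsilon> where "\<epsilon> n = inverse (real (Suc n))" for n
  have "\<exists>p\<in>C. \<Phi> p < m + \<epsilon> n" for n
    using cInf_lessD[of "\<Phi> ` C" "m + \<epsilon> n"] ne by (auto simp: m_def \<epsilon>_def)
  then obtain p where pC: "\<And>n. p n \<in> C" and p_lt: "\<And>n. \<Phi> (p n) < m + \<epsilon> n" by metis
  \<comment> \<open>Strong convexity at the midpoint: the midpoint value is at least m, and both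
    endpoints are within epsilon of m. Hence first coordinates of the minimizing sequence form a
    Cauchy sequence.\<close>
  have est: "c * norm (fst (p k) - fst (p n)) ^ 2 \<le> 4 * (\<epsilon> n + \<epsilon> k)" for n k
  proof -
    let ?q = "p n + (1/2) *\<^sub>R (p k - p n)"
    have "?q = (1/2) *\<^sub>R p n + (1/2) *\<^sub>R p k"
      using scaleR_half_double[of "p n"] by (simp add: algebra_simps)
    also have "\<dots> \<in> C" by (intro convexD[OF cC pC pC]) auto
    finally have "m \<le> \<Phi> ?q" by (rule m_le)
    moreover define L Q where "L = snd (p k) - snd (p n) - B (x0 - J (fst (p n) - x0)) (fst (p k) - fst (p n))"
      and "Q = B (J (fst (p k) - fst (p n))) (fst (p k) - fst (p n))"
    ultimately have "m \<le> \<Phi> (p n) + 1/2 * L + (1/2)^2 * (Q / 2)"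
      using Phi_line[of "p n" "1/2" "p k"] by simp
    moreover have "\<Phi> (p k) = \<Phi> (p n) + L + Q / 2"
      using Phi_line[of "p n" 1 "p k"] by (simp add: L_def Q_def)
    moreover have "c * norm (fst (p k) - fst (p n)) ^ 2 \<le> Q" unfolding Q_def by (rule c(2))
    ultimately show ?thesis using p_lt[of n] p_lt[of k] by (simp add: power2_eq_square)
  qed
  have "Cauchy (\<lambda>n. fst (p n))"
  proof (rule metric_CauchyI)
    fix e :: real assume e: "e > 0"
    have "c * e^2 / 8 > 0" using c(1) e by simp
    then obtain M where M: "\<epsilon> M < c * e^2 / 8" unfolding \<epsilon>_def by (rule reals_Archimedean[THEN exE])
    have "dist (fst (p k)) (fst (p n)) < e" if "k \<ge> M" "n \<ge> M" for k n
    proof -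
      have "\<epsilon> n \<le> \<epsilon> M" "\<epsilon> k \<le> \<epsilon> M"
        using that by (auto simp: \<epsilon>_def intro!: le_imp_inverse_le)
      then have "4 * (\<epsilon> n + \<epsilon> k) \<le> 8 * \<epsilon> M" by simp
      also have "8 * \<epsilon> M < c * e^2" using M by simp
      finally have "c * norm (fst (p k) - fst (p n)) ^ 2 < c * e^2" using est[where n=n and k=k] by (rule le_less_trans[rotated])
      then have "norm (fst (p k) - fst (p n)) ^ 2 < e^2" by (rule mult_left_less_imp_less[OF _ less_imp_le[OF c(1)]])
      then show ?thesis unfolding dist_norm by (rule power_less_imp_less_base[OF _ less_imp_le[OF e]])
    qed
    then show "\<exists>M. \<forall>k\<ge>M. \<forall>n\<ge>M. dist (fst (p k)) (fst (p n)) < e"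
      by (intro exI[of _ M] allI impI)
  qed
  then have "convergent (\<lambda>n. fst (p n))" by (rule Cauchy_convergent)
  then obtain z0 where z0: "(\<lambda>n. fst (p n)) \<longlonglongrightarrow> z0" unfolding convergent_def by (rule exE)
  have lim: "(\<lambda>n. m + \<epsilon> n) \<longlonglongrightarrow> m + 0"
    unfolding \<epsilon>_def by (intro tendsto_add tendsto_const LIMSEQ_inverse_real_of_nat)
  have Pm: "(\<lambda>n. \<Phi> (p n)) \<longlonglongrightarrow> m"
  proof (rule real_tendsto_sandwich)
    show "\<forall>\<^sub>F n in sequentially. m \<le> \<Phi> (p n)" by (intro always_eventually allI m_le pC)
    show "\<forall>\<^sub>F n in sequentially. \<Phi> (p n) \<le> m + \<epsilon> n" by (intro always_eventually allI less_imp_le p_lt)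
    show "(\<lambda>n. m + \<epsilon> n) \<longlonglongrightarrow> m" using lim by simp
  qed (rule tendsto_const)
  \<comment> \<open>The second coordinates have no coercivity of their own; they converge because
    they are the sum of the converging values of Phi and a continuous function of the first
    coordinates.\<close>
  define rest where "rest z = minorant x0 z - B (J (z - x0)) (z - x0) / 2" for z
  have blJ: "bounded_linear J" using lJ by (simp only: linear_conv_bounded_linear)
  have crest: "continuous_on UNIV rest"
    unfolding rest_def by (intro continuous_intros bounded_linear.continuous_on[OF blJ]) simp
  have "(\<lambda>n. rest (fst (p n))) \<longlonglongrightarrow> rest z0"
    by (rule continuous_on_tendsto_compose[OF crest z0]) simp_all
  with Pm have "(\<lambda>n. \<Phi> (p n) + rest (fst (p n))) \<longlonglongrightarrow> m + rest z0" by (intro tendsto_intros)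
  then have r0: "(\<lambda>n. snd (p n)) \<longlonglongrightarrow> m + rest z0" by (simp add: \<Phi>_def rest_def)
  define r0 where "r0 = m + rest z0"
  have "(\<lambda>n. (fst (p n), snd (p n))) \<longlonglongrightarrow> (z0, r0)" unfolding r0_def by (intro tendsto_Pair z0 r0)
  then have inC: "(z0, r0) \<in> C" by (rule closed_sequentially[OF clC, rotated]) (simp add: pC)
  have Pz: "\<Phi> (z0, r0) = m" by (simp add: \<Phi>_def r0_def rest_def)
  have "r0 + B (x0 - J (z0 - x0)) (z - z0) \<le> r" if zr: "(z, r) \<in> C" for z r
  proof -
    define a b where "a = r - r0 - B (x0 - J (z0 - x0)) (z - z0)" and "b = B (J (z - z0)) (z - z0) / 2"
    \<comment> \<open>First-order optimality: move from the minimizer towards (z, r), divide by t,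
      and let t decrease to 0.\<close>
    have ev: "0 \<le> a + t * b" if t: "0 < t" "t < 1" for t
    proof -
      have "(1 - t) *\<^sub>R (z0, r0) + t *\<^sub>R (z, r) \<in> C" using t by (intro convexD[OF cC inC zr]) auto
      also have "(1 - t) *\<^sub>R (z0, r0) + t *\<^sub>R (z, r) = (z0, r0) + t *\<^sub>R ((z, r) - (z0, r0))"
        by (simp add: algebra_simps)
      finally have "m \<le> \<Phi> ((z0, r0) + t *\<^sub>R ((z, r) - (z0, r0)))" by (rule m_le)
      then have "m \<le> m + t * a + t^2 * b"
        using Phi_line[of "(z0, r0)" t "(z, r)"] Pz by (simp add: a_def b_def)
      then have "0 \<le> t * (a + t * b)" by (simp add: algebra_simps power2_eq_square)
      then show ?thesis using t by (simp add: zero_le_mult_iff)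
    qed
    have "((\<lambda>t. a + t * b) \<longlongrightarrow> a + 0 * b) (at_right 0)" by (intro tendsto_intros)
    moreover have "eventually (\<lambda>t::real. 0 < t \<and> t < 1) (at_right 0)"
      using eventually_at_right_real[of 0 "1::real"] by (auto elim: eventually_mono)
    then have "eventually (\<lambda>t. 0 \<le> a + t * b) (at_right 0)"
      by (rule eventually_mono) (use ev in auto)
    ultimately have "0 \<le> a + 0 * b" by (intro tendsto_lowerbound[of _ _ "at_right 0"]) auto
    then show ?thesis by (simp add: a_def)
  qed
  then show ?thesis using inC that by blast
qed

text \<open>Monotonicity is the tangent inequality between two touching points. For maximality let
  x0 be related to all touching points and take the minimizer (z0, r0) of the penalized problem. Its
  slope w also touches C, which forces w = z0 and r0 = \<open>quad z0\<close>; relatedness of x0 to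
  z0 then leaves only x0 = z0.\<close>

lemma maximal_above_quad_imp_maxS_monotone:
  assumes C: "maximal_above_quad C"
  shows "{x. (x, quad x) \<in> C} \<in> maxS_monotone S"
proof -
  let ?G = "{x. (x, quad x) \<in> C}"
  have ab: "\<And>z r. (z, r) \<in> C \<Longrightarrow> quad z \<le> r"
    using C by (auto simp: maximal_above_quad_def above_quad_def)
  have mono: "0 \<le> quad (x - y)" if "x \<in> ?G" "y \<in> ?G" for x y
    using maximal_above_quad_le[OF C, of x y "quad y"] that by (simp add: minorant_eq)
  have "x0 \<in> ?G" if x0: "\<And>x. x \<in> ?G \<Longrightarrow> 0 \<le> quad (x - x0)" for x0
  proof -
    obtain J where J: "fundamental_symmetry J" using fundamental_symmetry_exists by blast
    then have lJ: "linear J" and JJ: "\<And>x. J (J x) = x" and sJ: "\<And>x y. B (J x) y = B x (J y)"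
      by (auto simp: fundamental_symmetry_def)
    obtain c where c: "c > 0" "\<And>x. c * norm x ^ 2 \<le> B (J x) x"
      using J by (auto simp: fundamental_symmetry_def)
    have N0: "x = 0" if "B (J x) x \<le> 0" for x
    proof -
      have "c * norm x ^ 2 \<le> 0" using c(2)[of x] that by linarith
      then show ?thesis using c(1) by (simp add: mult_le_0_iff)
    qed
    have N1: "0 \<le> B (J x) x" for x
    using order_trans[OF mult_nonneg_nonneg[OF less_imp_le[OF c(1)] zero_le_power2] c(2)] .
    obtain z0 r0 where zr: "(z0, r0) \<in> C"
      and opt: "\<And>z r. (z, r) \<in> C \<Longrightarrow> r0 + B (x0 - J (z0 - x0)) (z - z0) \<le> r"
      using maximal_above_quad_minimizer[OF C J] by blast
    define h w where "h = z0 - x0" and "w = x0 - J h"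
    have wz: "w - z0 = - (h + J h)" by (simp add: w_def h_def)
    \<comment> \<open>J fixes \<open>h + J h\<close>, so on this vector the form agrees with the
      positive definite one; \<open>quad (w - z0)\<close> is nonnegative and vanishes only for w =
      z0.\<close>
    have Nq: "B (J (h + J h)) (h + J h) = 2 * quad (w - z0)"
      unfolding wz quad_minus by (simp add: linear_add[OF lJ] JJ quad_def add.commute)
    have r0: "quad z0 \<le> r0" using ab zr by blast
    have "minorant w z \<le> r" if "(z, r) \<in> C" for z r
    proof -
      have "minorant w z0 \<le> r0" using r0 N1[of "h + J h"] Nq by (simp add: minorant_eq)
      moreover have "r0 + B w (z - z0) \<le> r" using opt[OF that] by (simp add: w_def h_def)
      ultimately show ?thesis by (simp add: minorant_def B_simps)
    qed
    then have "(w, quad w) \<in> C" by (rule maximal_above_quad_mem[OF C])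
    from opt[OF this] have "r0 + B w (w - z0) \<le> quad w" by (simp add: w_def h_def)
    then have "r0 \<le> minorant w z0" by (simp add: minorant_def quad_def B_simps)
    then have "r0 + quad (w - z0) \<le> quad z0" by (simp add: minorant_eq)
    then have q0: "quad (w - z0) \<le> 0" using r0 by linarith
    then have "h + J h = 0" using Nq by (intro N0) simp
    then have Jh: "J h = - h" using minus_unique by force
    then have "quad (w - z0) = 0" by (simp add: wz quad_def B_simps)
    then have "r0 = quad z0" using \<open>r0 + quad (w - z0) \<le> quad z0\<close> r0 by simp
    then have zG: "z0 \<in> ?G" using zr by simp
    from x0[OF zG] have "0 \<le> quad h" by (simp add: h_def)
    \<comment> \<open>On a vector with \<open>J h = - h\<close> the form is negative definite, while
      relatedness of x0 and z0 makes \<open>quad h\<close> nonnegative.\<close>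
    then have "B (J h) h \<le> 0" unfolding Jh by (simp add: B_simps quad_def)
    then have "h = 0" by (rule N0)
    then show "x0 \<in> ?G" using zG by (simp add: h_def)
  qed
  note mem = this
  have "H = ?G" if H: "S_monotone S H" "?G \<subseteq> H" for H
  proof (rule antisym[OF subsetI H(2)])
    fix x0 assume "x0 \<in> H"
    then show "x0 \<in> ?G"
      using H by (intro mem) (auto simp only: S_monotone_iff)
  qed
  then show ?thesis using mono by (simp add: maxS_monotone_def S_monotone_iff)
qed

text \<open>Supplies the dual candidate: \<open>C0\<close> is enlarged to a maximal set, whose
  touching points satisfy the tangent inequality against all of it.\<close>

lemma maxS_monotone_minorant_exists:
  assumes "above_quad C0" "C0 \<noteq> {}"
  obtains G where "G \<in> maxS_monotone S" "\<And>x z r. x \<in> G \<Longrightarrow> (z, r) \<in> C0 \<Longrightarrow> minorant x z \<le> r"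
proof -
  obtain C where C: "maximal_above_quad C" "C0 \<subseteq> C"
    using maximal_above_quad_exists[OF assms] .
  show ?thesis
    using that[OF maximal_above_quad_imp_maxS_monotone[OF C(1)]] maximal_above_quad_le[OF C(1)] C(2)
    by blast
qed

end

section \<open>Martingale plans\<close>

definition square_integrable :: "'a measure \<Rightarrow> ('a \<Rightarrow> real) \<Rightarrow> bool" where
  "square_integrable M g \<longleftrightarrow> g \<in> borel_measurable M \<and> integrable M (\<lambda>x. (g x)\<^sup>2)"

lemma square_integrable_measurable [measurable_dest]: "square_integrable M g \<Longrightarrow> g \<in> borel_measurable M"
  by (simp add: square_integrable_def)

lemma square_integrable_mult:
  assumes f: "square_integrable M f" and g: "square_integrable M g"
  shows "integrable M (\<lambda>x. f x * g x)"
proof (rule Bochner_Integration.integrable_bound)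
  show "integrable M (\<lambda>x. (f x)\<^sup>2 + (g x)\<^sup>2)"
    using f g by (simp add: square_integrable_def)
  show "(\<lambda>x. f x * g x) \<in> borel_measurable M" using f g by measurable
  have "\<bar>a * b\<bar> \<le> a\<^sup>2 + b\<^sup>2" for a b :: real
  proof -
    have "2 * \<bar>a\<bar> * \<bar>b\<bar> \<le> a\<^sup>2 + b\<^sup>2" using sum_squares_bound[of "\<bar>a\<bar>" "\<bar>b\<bar>"] by simp
    moreover have "0 \<le> \<bar>a\<bar> * \<bar>b\<bar>" by simp
    ultimately show ?thesis by (simp only: abs_mult)
  qed
  then show "AE x in M. norm (f x * g x) \<le> norm ((f x)\<^sup>2 + (g x)\<^sup>2)" by (simp add: abs_of_nonneg)
qed

lemma square_integrable_add:
  assumes f: "square_integrable M f" and g: "square_integrable M g"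
  shows "square_integrable M (\<lambda>x. f x + g x)"
proof -
  have "integrable M (\<lambda>x. (f x)\<^sup>2 + (g x)\<^sup>2 + 2 * (f x * g x))"
    using f g square_integrable_mult[OF f g] by (simp add: square_integrable_def)
  then have "integrable M (\<lambda>x. (f x + g x)\<^sup>2)" by (simp add: power2_sum mult.assoc)
  moreover have "(\<lambda>x. f x + g x) \<in> borel_measurable M" using f g by measurable
  ultimately show ?thesis by (simp add: square_integrable_def)
qed

lemma square_integrable_cmult: "square_integrable M f \<Longrightarrow> square_integrable M (\<lambda>x. c * f x)"
  by (auto simp: square_integrable_def power_mult_distrib)

lemma square_integrable_diff:
  "square_integrable M f \<Longrightarrow> square_integrable M g \<Longrightarrow> square_integrable M (\<lambda>x. f x - g x)"
  using square_integrable_add[of M f "\<lambda>x. (-1) * g x"] square_integrable_cmult[of M g "-1"] by simp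

lemma square_integrable_sum:
  "(\<And>i. i \<in> I \<Longrightarrow> square_integrable M (f i)) \<Longrightarrow> square_integrable M (\<lambda>x. \<Sum>i\<in>I. f i x)"
proof (induction I rule: infinite_finite_induct)
  case (insert i I)
  then show ?case by (simp add: square_integrable_add)
qed (simp_all add: square_integrable_def)

lemma square_integrable_bounded_mult:
  assumes f: "square_integrable M f" and [measurable]: "g \<in> borel_measurable M"
    and g: "AE x in M. \<bar>g x\<bar> \<le> K"
  shows "square_integrable M (\<lambda>x. g x * f x)"
proof -
  have [measurable]: "f \<in> borel_measurable M" using f by measurable
  have "integrable M (\<lambda>x. (g x * f x)\<^sup>2)"
  proof (rule Bochner_Integration.integrable_bound)
    show "integrable M (\<lambda>x. K\<^sup>2 * (f x)\<^sup>2)" using f by (simp add: square_integrable_def)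
    show "AE x in M. norm ((g x * f x)\<^sup>2) \<le> norm (K\<^sup>2 * (f x)\<^sup>2)"
      using g by eventually_elim (simp add: power_mult_distrib abs_le_square_iff[symmetric] mult_right_mono)
  qed measurable
  then show ?thesis by (simp add: square_integrable_def)
qed

lemma (in finite_measure) square_integrable_bounded:
  assumes [measurable]: "g \<in> borel_measurable M" and g: "AE x in M. \<bar>g x\<bar> \<le> K"
  shows "square_integrable M g"
  using square_integrable_bounded_mult[of M "\<lambda>_. 1", OF _ assms]
  by (simp add: square_integrable_def)

lemma (in finite_measure) square_integrable_imp_integrable:
  "square_integrable M f \<Longrightarrow> integrable M f"
  using square_integrable_mult[of M f "\<lambda>_. 1"] by (simp add: square_integrable_def)

text \<open>Reduces the clause on \<open>real_cond_exp\<close> to integrals over events of the first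
  coordinate, by the characterization of conditional expectation. This is the form in which a
  perturbed plan can be checked.\<close>

lemma GammaI:
  fixes \<gamma> :: "((real^'n) \<times> (real^'n)) measure"
  assumes "prob_space \<gamma>" and sets: "sets \<gamma> = sets borel"
    and int: "integrable \<gamma> (\<lambda>p. norm p ^ 2)" and "distr \<gamma> borel snd = \<nu>"
    and eq: "\<And>i B. B \<in> sets borel \<Longrightarrow> (\<integral>p. indicator B (fst p) * (snd p $ i - fst p $ i) \<partial>\<gamma>) = 0"
  shows "\<gamma> \<in> Gamma \<nu>"
proof -
  interpret prob_space \<gamma> by fact
  let ?F = "vimage_algebra (space \<gamma>) fst borel"
  have sp: "space \<gamma> = UNIV" using sets_eq_imp_space_eq[OF sets] by simp
  have meas: "g \<in> borel_measurable \<gamma>" if "continuous_on UNIV g" for g :: "_ \<Rightarrow> 'c::topological_space"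
    using borel_measurable_continuous_onI[OF that] measurable_cong_sets[OF sets refl] by blast
  have fst_meas: "fst \<in> borel_measurable \<gamma>" by (intro meas continuous_intros)
  have sub: "subalgebra \<gamma> ?F"
    unfolding subalgebra_def using measurable_sets[OF fst_meas] by (auto simp: sets_vimage_algebra2 sp)
  interpret finite_measure_subalgebra \<gamma> ?F
    by unfold_locales (rule sub)
  have fstF: "fst \<in> borel_measurable ?F" by (rule measurable_vimage_algebra1) simp
  have one: "\<bar>x $ i\<bar> \<le> 1 + norm x ^ 2" for x :: "real^'n" and i
  proof -
    have "\<bar>x $ i\<bar> \<le> norm x" by (rule component_le_norm_cart)
    also have "\<dots> \<le> 1 + norm x ^ 2" using sum_squares_bound[of "norm x" 1] norm_ge_zero[of x] by (simp del: norm_ge_zero)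
    finally show ?thesis .
  qed
  have bnd: "norm (snd p) ^ 2 \<le> norm p ^ 2" "norm (fst p) ^ 2 \<le> norm p ^ 2" for p :: "(real^'n) \<times> (real^'n)"
    using norm_snd_le[of "snd p" "fst p"] norm_fst_le[of "fst p" "snd p"] by (simp_all add: power_mono)
  have c1: "continuous_on UNIV (\<lambda>p::(real^'n) \<times> (real^'n). snd p $ i)"
    and c2: "continuous_on UNIV (\<lambda>p::(real^'n) \<times> (real^'n). fst p $ i)" for i
    by (intro continuous_intros)+
  have intY: "integrable \<gamma> (\<lambda>p. snd p $ i)" for i
  proof (rule Bochner_Integration.integrable_bound)
    show "integrable \<gamma> (\<lambda>p. 1 + norm p ^ 2)" using int by simp
    have "\<bar>snd p $ i\<bar> \<le> 1 + norm p ^ 2" for p :: "(real^'n) \<times> (real^'n)"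
      using one[of "snd p" i] bnd(1)[of p] by linarith
    then show "AE p in \<gamma>. norm (snd p $ i) \<le> norm (1 + norm p ^ 2)" by (simp add: abs_of_nonneg)
  qed (rule meas[OF c1])
  have intX: "integrable \<gamma> (\<lambda>p. fst p $ i)" for i
  proof (rule Bochner_Integration.integrable_bound)
    show "integrable \<gamma> (\<lambda>p. 1 + norm p ^ 2)" using int by simp
    have "\<bar>fst p $ i\<bar> \<le> 1 + norm p ^ 2" for p :: "(real^'n) \<times> (real^'n)"
      using one[of "fst p" i] bnd(2)[of p] by linarith
    then show "AE p in \<gamma>. norm (fst p $ i) \<le> norm (1 + norm p ^ 2)" by (simp add: abs_of_nonneg)
  qed (rule meas[OF c2])
  have "AE p in \<gamma>. real_cond_exp \<gamma> ?F (\<lambda>q. snd q $ i) p = fst p $ i" for i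
  proof (rule real_cond_exp_charact)
    fix A assume "A \<in> sets ?F"
    then obtain B where B: "B \<in> sets borel" "A = fst -` B \<inter> space \<gamma>"
      by (auto simp: sets_vimage_algebra2 sp)
    have A: "A \<in> sets \<gamma>" unfolding B(2) by (rule measurable_sets[OF fst_meas B(1)])
    have ind: "indicator A p = (indicator B (fst p) :: real)" for p
      by (simp add: B sp indicator_def)
    have "(LINT p:A|\<gamma>. snd p $ i) - (LINT p:A|\<gamma>. fst p $ i)
        = (\<integral>p. indicator A p *\<^sub>R (snd p $ i) - indicator A p *\<^sub>R (fst p $ i) \<partial>\<gamma>)"
      unfolding set_lebesgue_integral_def
      by (intro Bochner_Integration.integral_diff[symmetric] integrable_mult_indicator A intY intX)
    also have "\<dots> = (\<integral>p. indicator B (fst p) * (snd p $ i - fst p $ i) \<partial>\<gamma>)"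
      by (intro Bochner_Integration.integral_cong) (simp_all add: ind right_diff_distrib)
    finally show "(LINT p:A|\<gamma>. snd p $ i) = (LINT p:A|\<gamma>. fst p $ i)" using eq[OF B(1)] by simp
  next
    show "(\<lambda>p. fst p $ i) \<in> borel_measurable ?F"
      by (rule measurable_compose[OF fstF]) (intro borel_measurable_continuous_onI continuous_intros)
  qed (rule intY intX)+
  then show ?thesis using assms by (simp add: Gamma_def)
qed

section \<open>The martingale property tested by functions of the first coordinate\<close>

locale martingale_plan =
  fixes \<nu> :: "(real^'n) measure" and \<gamma> :: "((real^'n) \<times> (real^'n)) measure"
  assumes plan: "\<gamma> \<in> Gamma \<nu>"
begin

definition F :: "((real^'n) \<times> (real^'n)) measure" where
  "F = vimage_algebra (space \<gamma>) fst borel"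

lemma sets_plan: "sets \<gamma> = sets borel" using plan by (simp add: Gamma_def)

lemma space_plan [simp]: "space \<gamma> = UNIV" using sets_eq_imp_space_eq[OF sets_plan] by simp

sublocale prob_space \<gamma> using plan by (simp add: Gamma_def)

lemma borel_measurable_plan:
  "g \<in> borel_measurable borel \<Longrightarrow> g \<in> borel_measurable \<gamma>"
  using measurable_cong_sets[OF sets_plan refl] by blast

lemma continuous_measurable_plan:
  fixes g :: "(real^'n) \<times> (real^'n) \<Rightarrow> 'c::topological_space"
  shows "continuous_on UNIV g \<Longrightarrow> g \<in> borel_measurable \<gamma>"
  by (intro borel_measurable_plan borel_measurable_continuous_onI)

lemma fst_measurable [measurable]: "fst \<in> borel_measurable \<gamma>"
  and snd_measurable [measurable]: "snd \<in> borel_measurable \<gamma>"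
  by (intro continuous_measurable_plan continuous_intros)+

sublocale finite_measure_subalgebra \<gamma> F
proof unfold_locales
  show "subalgebra \<gamma> F"
    unfolding subalgebra_def F_def using measurable_sets[OF fst_measurable]
    by (auto simp: sets_vimage_algebra2)
qed

lemma fst_measurable_F: "fst \<in> borel_measurable F"
  unfolding F_def by (rule measurable_vimage_algebra1) simp

lemma fst_comp_measurable_F: "g \<in> borel_measurable borel \<Longrightarrow> (\<lambda>p. g (fst p)) \<in> borel_measurable F"
  by (rule measurable_compose[OF fst_measurable_F])

lemma integrable_norm_sq: "integrable \<gamma> (\<lambda>p. norm p ^ 2)" using plan by (simp add: Gamma_def)

lemma second_marginal: "distr \<gamma> borel snd = \<nu>" using plan by (simp add: Gamma_def)

lemma square_integrable_linear:
  assumes "g \<in> borel_measurable \<gamma>" and "\<And>p. \<bar>g p\<bar> \<le> C * norm p"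
  shows "square_integrable \<gamma> g"
proof -
  have [measurable]: "g \<in> borel_measurable \<gamma>" by fact
  have "integrable \<gamma> (\<lambda>p. (g p)\<^sup>2)"
  proof (rule Bochner_Integration.integrable_bound)
    show "integrable \<gamma> (\<lambda>p. C\<^sup>2 * norm p ^ 2)" using integrable_norm_sq by simp
    have "norm ((g p)\<^sup>2) \<le> norm (C\<^sup>2 * norm p ^ 2)" for p
      using power_mono[OF assms(2)[of p] abs_ge_zero, of 2] by (simp add: power_mult_distrib)
    then show "AE p in \<gamma>. norm ((g p)\<^sup>2) \<le> norm (C\<^sup>2 * norm p ^ 2)" by (rule AE_I2)
  qed measurable
  then show ?thesis by (simp add: square_integrable_def assms)
qed

lemma square_integrable_fst: "square_integrable \<gamma> (\<lambda>p. fst p $ i)"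
  and square_integrable_snd: "square_integrable \<gamma> (\<lambda>p. snd p $ i)"
proof -
  show "square_integrable \<gamma> (\<lambda>p. fst p $ i)"
  proof (rule square_integrable_linear)
    show "\<bar>fst p $ i\<bar> \<le> 1 * norm p" for p :: "(real^'n) \<times> (real^'n)"
      using component_le_norm_cart[of "fst p" i] norm_fst_le[of "fst p" "snd p"] by simp
  qed (intro continuous_measurable_plan continuous_intros)
  show "square_integrable \<gamma> (\<lambda>p. snd p $ i)"
  proof (rule square_integrable_linear)
    show "\<bar>snd p $ i\<bar> \<le> 1 * norm p" for p :: "(real^'n) \<times> (real^'n)"
      using component_le_norm_cart[of "snd p" i] norm_snd_le[of "snd p" "fst p"] by simp
  qed (intro continuous_measurable_plan continuous_intros)
qed

text \<open>The working form of the martingale constraint: h, a function of the first coordinate, is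
  pulled out of the conditional expectation. Square-integrability of h makes the products
  integrable.\<close>

lemma martingale_test:
  assumes h: "square_integrable \<gamma> h" and hF: "h \<in> borel_measurable F"
  shows "(\<integral>p. h p * (snd p $ i - fst p $ i) \<partial>\<gamma>) = 0"
proof -
  note iX = square_integrable_mult[OF h square_integrable_fst[of i]]
  note iY = square_integrable_mult[OF h square_integrable_snd[of i]]
  have mY: "(\<lambda>p. snd p $ i) \<in> borel_measurable \<gamma>"
    by (rule square_integrable_measurable[OF square_integrable_snd])
  have ae: "AE p in \<gamma>. real_cond_exp \<gamma> F (\<lambda>q. snd q $ i) p = fst p $ i"
    using plan by (simp add: Gamma_def F_def)
  have "(\<integral>p. h p * snd p $ i \<partial>\<gamma>) = (\<integral>p. h p * real_cond_exp \<gamma> F (\<lambda>q. snd q $ i) p \<partial>\<gamma>)"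
    by (rule real_cond_exp_intg(2)[OF iY hF mY, symmetric])
  also have "\<dots> = (\<integral>p. h p * fst p $ i \<partial>\<gamma>)"
  proof (rule integral_cong_AE)
    show "(\<lambda>p. h p * real_cond_exp \<gamma> F (\<lambda>q. snd q $ i) p) \<in> borel_measurable \<gamma>"
      using h by measurable
    show "AE p in \<gamma>. h p * real_cond_exp \<gamma> F (\<lambda>q. snd q $ i) p = h p * fst p $ i"
      using ae by eventually_elim simp
  qed (use iX in auto)
  finally show ?thesis using iX iY by (simp add: right_diff_distrib)
qed

end

section \<open>Value of a plan\<close>

locale form_plan = nondegenerate_form S + martingale_plan \<nu> \<gamma>
  for S :: "real^'n^'n" and \<nu> :: "(real^'n) measure" and \<gamma> :: "((real^'n) \<times> (real^'n)) measure"
begin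

text \<open>Conditional expectations are available for real functions, so the form is split into
  scalar products to which \<open>martingale_test\<close> applies.\<close>

lemma B_component_sum: "B u y = (\<Sum>i\<in>UNIV. (S *v u) $ i * y $ i)"
  by (subst B_commute) (simp add: Sform_def inner_vec_def mult.commute)

lemma square_integrable_form:
  assumes "\<And>i. square_integrable \<gamma> (\<lambda>p. u p $ i)"
  shows "square_integrable \<gamma> (\<lambda>p. (S *v u p) $ i)"
proof -
  have "square_integrable \<gamma> (\<lambda>p. \<Sum>j\<in>UNIV. S $ i $ j * u p $ j)"
    by (intro square_integrable_sum square_integrable_cmult assms)
  then show ?thesis by (simp add: matrix_vector_mult_def)
qed

lemmas square_integrable_form_fst = square_integrable_form[OF square_integrable_fst]

lemma integrable_B_fst_fst: "integrable \<gamma> (\<lambda>p. B (fst p) (fst p))"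
  and integrable_B_fst_snd: "integrable \<gamma> (\<lambda>p. B (fst p) (snd p))"
  unfolding B_component_sum
  by (intro Bochner_Integration.integrable_sum square_integrable_mult square_integrable_form_fst
      square_integrable_fst square_integrable_snd)+

lemma integrable_quad_fst: "integrable \<gamma> (\<lambda>p. quad (fst p))"
  using integrable_B_fst_fst by (simp add: quad_def)

lemma integrable_minorant: "integrable \<gamma> (\<lambda>p. minorant (fst p) (snd p))"
  unfolding minorant_def using integrable_quad_fst integrable_B_fst_snd by simp

text \<open>Tested against the components of S x, the martingale property makes the bilinear cost
  depend on the law of the first coordinate alone.\<close>

lemma integral_B_fst_snd: "(\<integral>p. B (fst p) (snd p) \<partial>\<gamma>) = (\<integral>p. B (fst p) (fst p) \<partial>\<gamma>)"
proof -
  have SF: "(\<lambda>p. (S *v fst p) $ i) \<in> borel_measurable F" for i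
    by (intro fst_comp_measurable_F borel_measurable_continuous_onI continuous_intros
        linear_continuous_on matrix_vector_mul_bounded_linear)
  have "(\<integral>p. B (fst p) (snd p) \<partial>\<gamma>) - (\<integral>p. B (fst p) (fst p) \<partial>\<gamma>)
      = (\<integral>p. (\<Sum>i\<in>UNIV. (S *v fst p) $ i * (snd p $ i - fst p $ i)) \<partial>\<gamma>)"
    by (subst Bochner_Integration.integral_diff[symmetric, OF integrable_B_fst_snd integrable_B_fst_fst])
      (simp add: B_component_sum right_diff_distrib sum_subtractf)
  also have "\<dots> = (\<Sum>i\<in>UNIV. \<integral>p. (S *v fst p) $ i * (snd p $ i - fst p $ i) \<partial>\<gamma>)"
    by (intro Bochner_Integration.integral_sum square_integrable_mult square_integrable_diff
        square_integrable_form_fst square_integrable_fst square_integrable_snd)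
  also have "\<dots> = 0" by (intro sum.neutral ballI martingale_test square_integrable_form_fst SF)
  finally show ?thesis by simp
qed

lemma plan_value_eq: "plan_value S \<gamma> = (\<integral>p. quad (fst p) \<partial>\<gamma>)"
  by (simp add: plan_value_def integral_B_fst_snd quad_def)

lemma integral_minorant: "(\<integral>p. minorant (fst p) (snd p) \<partial>\<gamma>) = plan_value S \<gamma>"
proof -
  have "(\<integral>p. minorant (fst p) (snd p) \<partial>\<gamma>) = (\<integral>p. B (fst p) (snd p) \<partial>\<gamma>) - (\<integral>p. quad (fst p) \<partial>\<gamma>)"
    unfolding minorant_def by (rule Bochner_Integration.integral_diff[OF integrable_B_fst_snd integrable_quad_fst])
  then show ?thesis by (simp add: integral_B_fst_snd plan_value_eq quad_def)
qed

end

section \<open>First variation of an optimal plan\<close>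

text \<open>The law of a randomized map: given x, a coin with success probability
  \<open>\<theta> x\<close> decides between \<open>\<psi> x\<close> and \<open>\<phi> x\<close>. The
  coin is a second factor \<open>bool\<close>, weighted by a density, so that integrals against the
  law follow from Fubini.\<close>

lemma mixture_exists:
  fixes \<gamma> :: "'a measure" and N :: "'b measure"
  assumes "prob_space \<gamma>" and \<theta>[measurable]: "\<theta> \<in> borel_measurable \<gamma>"
    and \<theta>01: "\<And>x. 0 \<le> \<theta> x \<and> \<theta> x \<le> (1::real)"
    and \<phi>[measurable]: "\<phi> \<in> measurable \<gamma> N" and \<psi>[measurable]: "\<psi> \<in> measurable \<gamma> N"
  obtains \<mu> where "prob_space \<mu>" "sets \<mu> = sets N"
    "\<And>g::'b \<Rightarrow> real. g \<in> borel_measurable N \<Longrightarrow> integrable \<gamma> (\<lambda>x. g (\<phi> x)) \<Longrightarrow>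
      integrable \<gamma> (\<lambda>x. g (\<psi> x)) \<Longrightarrow>
      integrable \<mu> g \<and> (\<integral>x. g x \<partial>\<mu>) = (\<integral>x. (1 - \<theta> x) * g (\<phi> x) + \<theta> x * g (\<psi> x) \<partial>\<gamma>)"
proof -
  interpret prob_space \<gamma> by fact
  let ?C = "count_space (UNIV :: bool set)"
  interpret C: finite_measure ?C by (rule finite_measure_count_space) simp
  interpret P: pair_sigma_finite \<gamma> ?C ..
  let ?P = "\<gamma> \<Otimes>\<^sub>M ?C"
  define D :: "'a \<times> bool \<Rightarrow> real" where "D = (\<lambda>q. if snd q then \<theta> (fst q) else 1 - \<theta> (fst q))"
  define \<Phi> where "\<Phi> = (\<lambda>q. if snd q then \<psi> (fst q) else \<phi> (fst q))"
  have D[measurable]: "D \<in> borel_measurable ?P" unfolding D_def by measurable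
  have D0: "0 \<le> D q" for q using \<theta>01[of "fst q"] by (simp add: D_def)
  have \<Phi>[measurable]: "\<Phi> \<in> measurable ?P N" unfolding \<Phi>_def by measurable
  define \<mu> where "\<mu> = distr (density ?P (\<lambda>q. ennreal (D q))) N \<Phi>"
  have sets: "sets \<mu> = sets N" by (simp add: \<mu>_def)
  have key: "integrable \<mu> g \<and> (\<integral>x. g x \<partial>\<mu>) = (\<integral>x. (1 - \<theta> x) * g (\<phi> x) + \<theta> x * g (\<psi> x) \<partial>\<gamma>)"
    if g[measurable]: "g \<in> borel_measurable N" and i: "integrable \<gamma> (\<lambda>x. g (\<phi> x))" "integrable \<gamma> (\<lambda>x. g (\<psi> x))"
    for g :: "'b \<Rightarrow> real"
  proof -
    let ?h = "\<lambda>q. D q * g (\<Phi> q)"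
    have bsum: "(\<integral>b. k b \<partial>?C) = k False + k True" for k :: "bool \<Rightarrow> real"
      by (simp add: lebesgue_integral_count_space_finite UNIV_bool)
    have hs: "?h (x, False) = (1 - \<theta> x) * g (\<phi> x)" "?h (x, True) = \<theta> x * g (\<psi> x)" for x
      by (simp_all add: D_def \<Phi>_def)
    have i2: "integrable \<gamma> (\<lambda>x. (1 - \<theta> x) * g (\<phi> x))" "integrable \<gamma> (\<lambda>x. \<theta> x * g (\<psi> x))"
      by (rule Bochner_Integration.integrable_bound[OF i(1)], simp, use \<theta>01 in \<open>simp add: abs_mult mult_left_le_one_le\<close>)
        (rule Bochner_Integration.integrable_bound[OF i(2)], simp, use \<theta>01 in \<open>simp add: abs_mult mult_left_le_one_le\<close>)
    have ih: "integrable ?P ?h"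
    proof (rule P.Fubini_integrable)
      show "?h \<in> borel_measurable ?P" by measurable
      show "integrable \<gamma> (\<lambda>x. \<integral>y. norm (?h (x, y)) \<partial>?C)"
        unfolding bsum hs using i2 by (intro Bochner_Integration.integrable_add integrable_norm)
      show "AE x in \<gamma>. integrable ?C (\<lambda>y. ?h (x, y))"
        by (intro AE_I2 integrable_count_space) simp
    qed
    have int_density: "integrable (density ?P (\<lambda>q. ennreal (D q))) (\<lambda>q. g (\<Phi> q))"
      using ih D0 by (subst integrable_density) (auto intro: AE_I2)
    have "integrable \<mu> g" unfolding \<mu>_def using int_density by (subst integrable_distr_eq) auto
    moreover have "(\<integral>x. g x \<partial>\<mu>) = (\<integral>q. g (\<Phi> q) \<partial>density ?P (\<lambda>q. ennreal (D q)))"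
      unfolding \<mu>_def by (rule integral_distr) auto
    moreover have "\<dots> = (\<integral>q. ?h q \<partial>?P)"
      using D0 by (subst integral_density) (auto intro: AE_I2)
    moreover have "\<dots> = (\<integral>x. (\<integral>y. ?h (x, y) \<partial>?C) \<partial>\<gamma>)"
      using P.integral_fst'[OF ih] by simp
    moreover have "\<dots> = (\<integral>x. (1 - \<theta> x) * g (\<phi> x) + \<theta> x * g (\<psi> x) \<partial>\<gamma>)" unfolding bsum hs ..
    ultimately show ?thesis by simp
  qed
  have "integrable \<mu> (\<lambda>_. 1::real) \<and> (\<integral>x. 1 \<partial>\<mu>) = (\<integral>x. (1 - \<theta> x) * 1 + \<theta> x * 1 \<partial>\<gamma>)"
    by (rule key) simp_all
  then have one: "integrable \<mu> (\<lambda>_. 1::real)" "(\<integral>x. 1 \<partial>\<mu>) = (1::real)"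
    by (simp_all add: prob_space)
  then have "finite_measure \<mu>" by (intro finite_measureI) (simp add: integrable_iff_bounded less_top[symmetric])
  then interpret M: finite_measure \<mu> .
  have "prob_space \<mu>" using one by (intro prob_spaceI) (simp add: M.emeasure_eq_measure)
  then show ?thesis using that sets key by blast
qed

lemma integrable_bounded_mult:
  fixes g u :: "'a \<Rightarrow> real"
  assumes "integrable M g" "u \<in> borel_measurable M" "\<And>x. \<bar>u x\<bar> \<le> K"
  shows "integrable M (\<lambda>x. u x * g x)"
proof (rule Bochner_Integration.integrable_bound)
  show "integrable M (\<lambda>x. K * \<bar>g x\<bar>)" using assms(1) by simp
  show "(\<lambda>x. u x * g x) \<in> borel_measurable M" using assms(1,2) by simp
  have "norm (u x * g x) \<le> norm (K * \<bar>g x\<bar>)" for x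
    using mult_right_mono[OF order_trans[OF assms(3)[of x] abs_ge_self] abs_ge_zero[of "g x"]]
    by (simp add: abs_mult)
  then show "AE x in M. norm (u x * g x) \<le> norm (K * \<bar>g x\<bar>)" by (rule AE_I2)
qed

context form_plan
begin

text \<open>A first variation of a plan: conditioned on an event of probability \<open>\<delta>\<close> with density \<open>w\<close>
  the first coordinate is moved to the conditional mean \<open>z\<close> of \<open>y\<close>, and elsewhere it is moved to
  the new conditional mean of \<open>y\<close>, which differs from \<open>x\<close> by \<open>O(\<delta>)\<close>.\<close>

lemma optimal_plan_variation:
  assumes opt: "optimal_plan S \<nu> \<gamma>"
    and w[measurable]: "w \<in> borel_measurable \<gamma>" and w0: "\<And>p. 0 \<le> w p" and wK: "\<And>p. w p \<le> K"
    and w1: "(\<integral>p. w p \<partial>\<gamma>) = 1" and z: "\<And>i. z $ i = (\<integral>p. w p * snd p $ i \<partial>\<gamma>)"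
  shows "quad z \<le> (\<integral>p. w p * minorant (fst p) (snd p) \<partial>\<gamma>)"
proof -
  have K0: "0 < K"
  proof (rule ccontr)
    assume "\<not> 0 < K"
    then have "w p = 0" for p using w0[of p] wK[of p] by linarith
    then show False using w1 by simp
  qed
  have wK': "\<bar>w p\<bar> \<le> K" for p using w0[of p] wK[of p] by simp
  have w2: "square_integrable \<gamma> w" using wK' by (intro square_integrable_bounded AE_I2) auto
  have iw: "integrable \<gamma> w" by (rule square_integrable_imp_integrable[OF w2])
  define e where "e i p = w p * (snd p $ i - fst p $ i)" for i and p :: "(real^'n) \<times> (real^'n)"
  have e2: "square_integrable \<gamma> (e i)" for i
    unfolding e_def
    by (rule square_integrable_bounded_mult[OF square_integrable_diff[OF square_integrable_snd square_integrable_fst] w AE_I2[OF wK']])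
  \<comment> \<open>To first order in delta, removing the mass \<open>\<delta> * w\<close> shifts
    the conditional mean of y given x by \<open>- \<delta> * c\<close>.\<close>
  define c where "c i = real_cond_exp \<gamma> F (e i)" for i
  have cF: "c i \<in> borel_measurable F" for i unfolding c_def by (rule borel_measurable_cond_exp)
  have c2: "square_integrable \<gamma> (c i)" for i
  proof -
    have "integrable \<gamma> (\<lambda>p. (real_cond_exp \<gamma> F (e i) p)\<^sup>2)"
      using e2[of i] square_integrable_imp_integrable[OF e2[of i]]
      by (intro integrable_convex_cond_exp[where I=UNIV and q="\<lambda>t. t\<^sup>2"])
        (auto simp: square_integrable_def convex_power2)
    then show ?thesis unfolding c_def square_integrable_def by (simp add: borel_measurable_cond_exp2)
  qed
  define a0 where "a0 = real_cond_exp \<gamma> F w"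
  \<comment> \<open>The conditional density \<open>a0\<close> lies in [0, K] almost everywhere only;
    clipping makes the bounds hold at every point, so that division by
    \<open>1 - \<delta> * a\<close> is safe.\<close>
  define a where "a p = max 0 (min K (a0 p))" for p
  have aF: "a \<in> borel_measurable F"
  proof -
    have "a0 \<in> borel_measurable F" unfolding a0_def by (rule borel_measurable_cond_exp)
    then show ?thesis unfolding a_def by measurable
  qed
  have a_bound: "0 \<le> a p" "a p \<le> K" for p using K0 by (auto simp: a_def)
  have ae_a: "AE p in \<gamma>. a0 p = a p"
  proof -
    have "AE p in \<gamma>. 0 \<le> a0 p" unfolding a0_def by (rule real_cond_exp_ge_c[OF iw]) (simp add: w0)
    moreover have "AE p in \<gamma>. a0 p \<le> K" unfolding a0_def by (rule real_cond_exp_le_c[OF iw]) (simp add: wK)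
    ultimately show ?thesis by eventually_elim (simp add: a_def)
  qed
  obtain C where C0: "C > 0" and C: "\<And>x y. \<bar>B x y\<bar> \<le> C * norm x * norm y" using B_bound by blast
  \<comment> \<open>A bound for the second-order term that does not involve delta: the norm of k is
    at most twice that of c, and \<open>\<bar>quad v\<bar>\<close> is at most C/2 times the squared
    norm of v.\<close>
  define R where "R = 2 * C * (\<Sum>i\<in>UNIV. \<integral>p. (c i p)\<^sup>2 \<partial>\<gamma>)"
  have ineq: "quad z \<le> (\<integral>p. w p * minorant (fst p) (snd p) \<partial>\<gamma>) + \<delta> * R"
    if \<delta>: "0 < \<delta>" "\<delta> \<le> 1 / (2 * K)" for \<delta>
  proof -
    have dK: "\<delta> * K \<le> 1/2" using \<delta>(2) K0 by (simp add: field_simps)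
    have d0: "0 \<le> \<delta>" using \<delta> by simp
    have dw: "0 \<le> \<delta> * w p" "\<delta> * w p \<le> 1/2" for p
      using mult_nonneg_nonneg[OF d0 w0] order_trans[OF mult_left_mono[OF wK d0] dK] by this
    have da: "1/2 \<le> 1 - \<delta> * a p" "1 - \<delta> * a p \<le> 1" for p
      using mult_nonneg_nonneg[OF d0 a_bound(1)] order_trans[OF mult_left_mono[OF a_bound(2) d0] dK] by simp_all
    \<comment> \<open>With this factor T is the conditional mean of y given x under the weight
      \<open>1 - \<delta> * w\<close>: the condition reads
      \<open>k * (1 - \<delta> * a) = c\<close>, componentwise.\<close>
    define s where "s p = 1 / (1 - \<delta> * a p)" for p
    have s: "0 \<le> s p" "s p \<le> 2" "s p * (1 - \<delta> * a p) = 1" for p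
      using da[of p] by (simp_all add: s_def field_simps)
    have sF: "s \<in> borel_measurable F" unfolding s_def using aF by measurable
    have sM[measurable]: "s \<in> borel_measurable \<gamma>" by (rule measurable_from_subalg[OF subalg sF])
    have sabs: "\<bar>s p\<bar> \<le> 2" for p using s[of p] by simp
    define k where "k p = (\<chi> i. s p * c i p)" for p
    define T where "T p = fst p - \<delta> *\<^sub>R k p" for p
    have k2: "square_integrable \<gamma> (\<lambda>p. k p $ i)" for i
      unfolding k_def using square_integrable_bounded_mult[OF c2 sM AE_I2[OF sabs]] by simp
    have kF: "(\<lambda>p. k p $ i) \<in> borel_measurable F" for i
      unfolding k_def using sF cF[of i] by simp
    have T2: "square_integrable \<gamma> (\<lambda>p. T p $ i)" for i
      unfolding T_def using square_integrable_diff[OF square_integrable_fst square_integrable_cmult[OF k2]] by simp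
    have TF: "T \<in> borel_measurable F"
    proof -
      have "(\<lambda>p. fst p $ i - \<delta> * k p $ i) \<in> borel_measurable F" for i
        by (intro borel_measurable_diff borel_measurable_times kF borel_measurable_const fst_comp_measurable_F
            borel_measurable_continuous_onI continuous_intros)
      then have "(\<lambda>p. T p \<bullet> b) \<in> borel_measurable F" if "b \<in> Basis" for b
        using that by (auto simp: Basis_vec_def inner_axis T_def)
      then show ?thesis by (subst borel_measurable_euclidean_space) simp
    qed
    have TM[measurable]: "T \<in> borel_measurable \<gamma>" by (rule measurable_from_subalg[OF subalg TF])
    \<comment> \<open>The martingale property of the unmoved part. It is used twice: with indicators
      of events of T, to certify the new plan, and with the components of S x, to cancel the
      first-order effect of T on the value.\<close>
    have test: "(\<integral>p. h p * ((1 - \<delta> * w p) * (snd p $ i - T p $ i)) \<partial>\<gamma>) = 0"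
      "integrable \<gamma> (\<lambda>p. h p * ((1 - \<delta> * w p) * (snd p $ i - T p $ i)))"
      if h: "square_integrable \<gamma> h" and hF: "h \<in> borel_measurable F" for h i
    proof -
      note hM[measurable] = square_integrable_measurable[OF h]
      have h1: "square_integrable \<gamma> (\<lambda>p. s p * h p)"
        by (rule square_integrable_bounded_mult[OF h sM AE_I2[OF sabs]])
      have I1: "integrable \<gamma> (\<lambda>p. h p * (snd p $ i - fst p $ i))"
        by (intro square_integrable_mult h square_integrable_diff square_integrable_fst square_integrable_snd)
      have I2: "integrable \<gamma> (\<lambda>p. h p * e i p)" by (rule square_integrable_mult[OF h e2])
      have hk: "integrable \<gamma> (\<lambda>p. h p * k p $ i)" by (rule square_integrable_mult[OF h k2])
      have I3: "integrable \<gamma> (\<lambda>p. (h p * k p $ i) * w p)"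
      proof -
        have "integrable \<gamma> (\<lambda>p. h p * (w p * k p $ i))"
          by (intro square_integrable_mult h square_integrable_bounded_mult[OF k2 w AE_I2[OF wK']])
        then show ?thesis by (simp add: mult_ac)
      qed
      have split: "h p * ((1 - \<delta> * w p) * (snd p $ i - T p $ i))
          = h p * (snd p $ i - fst p $ i) - \<delta> * (h p * e i p) + \<delta> * (h p * k p $ i)
            - \<delta>\<^sup>2 * ((h p * k p $ i) * w p)" for p
        by (simp add: T_def e_def algebra_simps power2_eq_square)
      show "integrable \<gamma> (\<lambda>p. h p * ((1 - \<delta> * w p) * (snd p $ i - T p $ i)))"
        unfolding split using I1 I2 I3 hk by simp
      have "(\<integral>p. h p * ((1 - \<delta> * w p) * (snd p $ i - T p $ i)) \<partial>\<gamma>)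
          = (\<integral>p. h p * (snd p $ i - fst p $ i) \<partial>\<gamma>) - \<delta> * (\<integral>p. h p * e i p \<partial>\<gamma>)
            + \<delta> * (\<integral>p. h p * k p $ i \<partial>\<gamma>) - \<delta>\<^sup>2 * (\<integral>p. (h p * k p $ i) * w p \<partial>\<gamma>)"
        unfolding split using I1 I2 I3 hk by simp
      also have "(\<integral>p. h p * (snd p $ i - fst p $ i) \<partial>\<gamma>) = 0" by (rule martingale_test[OF h hF])
      also have "(\<integral>p. h p * e i p \<partial>\<gamma>) = (\<integral>p. h p * c i p \<partial>\<gamma>)"
        unfolding c_def by (rule real_cond_exp_intg(2)[OF I2 hF square_integrable_measurable[OF e2], symmetric])
      also have "(\<integral>p. (h p * k p $ i) * w p \<partial>\<gamma>) = (\<integral>p. (h p * k p $ i) * a p \<partial>\<gamma>)"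
      proof -
        have hkF: "(\<lambda>p. h p * k p $ i) \<in> borel_measurable F" using hF kF by (rule borel_measurable_times)
        have "(\<integral>p. (h p * k p $ i) * w p \<partial>\<gamma>) = (\<integral>p. (h p * k p $ i) * a0 p \<partial>\<gamma>)"
          unfolding a0_def by (rule real_cond_exp_intg(2)[OF I3 hkF w, symmetric])
        also have "\<dots> = (\<integral>p. (h p * k p $ i) * a p \<partial>\<gamma>)"
        proof (rule integral_cong_AE)
          have a0M: "a0 \<in> borel_measurable \<gamma>" unfolding a0_def by (rule borel_measurable_cond_exp2)
          have aM: "a \<in> borel_measurable \<gamma>" by (rule measurable_from_subalg[OF subalg aF])
          have m: "(\<lambda>p. h p * k p $ i) \<in> borel_measurable \<gamma>" by (rule measurable_from_subalg[OF subalg hkF])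
          show "(\<lambda>p. (h p * k p $ i) * a0 p) \<in> borel_measurable \<gamma>" using m a0M by (rule borel_measurable_times)
          show "(\<lambda>p. (h p * k p $ i) * a p) \<in> borel_measurable \<gamma>" using m aM by (rule borel_measurable_times)
          show "AE p in \<gamma>. h p * k p $ i * a0 p = h p * k p $ i * a p" using ae_a by eventually_elim simp
        qed
        finally show ?thesis .
      qed
      also have "(\<integral>p. h p * c i p \<partial>\<gamma>) = (\<integral>p. h p * k p $ i - \<delta> * ((h p * k p $ i) * a p) \<partial>\<gamma>)"
      proof (rule Bochner_Integration.integral_cong[OF refl])
        fix p
        have "h p * k p $ i - \<delta> * ((h p * k p $ i) * a p) = h p * c i p * (s p * (1 - \<delta> * a p))"
          by (simp add: k_def algebra_simps)
        then show "h p * c i p = h p * k p $ i - \<delta> * ((h p * k p $ i) * a p)" by (simp add: s(3))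
      qed
      also have "\<dots> = (\<integral>p. h p * k p $ i \<partial>\<gamma>) - \<delta> * (\<integral>p. (h p * k p $ i) * a p \<partial>\<gamma>)"
      proof -
        have aM: "a \<in> borel_measurable \<gamma>" by (rule measurable_from_subalg[OF subalg aF])
        have "\<bar>a p\<bar> \<le> K" for p using a_bound[of p] by simp
        then have "integrable \<gamma> (\<lambda>p. h p * (a p * k p $ i))"
          by (intro square_integrable_mult h square_integrable_bounded_mult[OF k2 aM AE_I2])
        then have "integrable \<gamma> (\<lambda>p. (h p * k p $ i) * a p)" by (simp add: mult_ac)
        then show ?thesis using hk by simp
      qed
      finally show "(\<integral>p. h p * ((1 - \<delta> * w p) * (snd p $ i - T p $ i)) \<partial>\<gamma>) = 0"
        by (simp add: algebra_simps power2_eq_square)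
    qed
    define \<theta> where "\<theta> p = \<delta> * w p" for p
    have \<theta>M[measurable]: "\<theta> \<in> borel_measurable \<gamma>" unfolding \<theta>_def by measurable
    have \<theta>01: "0 \<le> \<theta> p \<and> \<theta> p \<le> 1" for p using dw[of p] by (simp add: \<theta>_def)
    have \<theta>abs: "\<bar>1 - \<theta> p\<bar> \<le> 1" "\<bar>\<theta> p\<bar> \<le> 1" for p using \<theta>01[of p] by simp_all
    have \<phi>M: "(\<lambda>p. (T p, snd p)) \<in> borel_measurable \<gamma>" and \<psi>M: "(\<lambda>p. (z, snd p)) \<in> borel_measurable \<gamma>"
      by measurable
    obtain \<mu> where "prob_space \<mu>" and \<mu>sets: "sets \<mu> = sets borel"
      and key: "\<And>g::(real^'n) \<times> (real^'n) \<Rightarrow> real. g \<in> borel_measurable borel \<Longrightarrow>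
        integrable \<gamma> (\<lambda>p. g (T p, snd p)) \<Longrightarrow> integrable \<gamma> (\<lambda>p. g (z, snd p)) \<Longrightarrow>
        integrable \<mu> g \<and> (\<integral>p. g p \<partial>\<mu>) = (\<integral>p. (1 - \<theta> p) * g (T p, snd p) + \<theta> p * g (z, snd p) \<partial>\<gamma>)"
      using mixture_exists[OF prob_space_axioms \<theta>M \<theta>01 \<phi>M \<psi>M] by blast
    interpret \<mu>: prob_space \<mu> by fact
    have fstB: "fst \<in> borel_measurable (borel :: ((real^'n) \<times> (real^'n)) measure)"
      and sndB: "snd \<in> borel_measurable (borel :: ((real^'n) \<times> (real^'n)) measure)"
      by (intro borel_measurable_continuous_onI continuous_intros)+
    have z2: "square_integrable \<gamma> (\<lambda>p. z $ i)" for i by (simp add: square_integrable_def)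
    have sq: "integrable \<gamma> (\<lambda>p. norm (u p, snd p) ^ 2)" if u: "\<And>i. square_integrable \<gamma> (\<lambda>p. u p $ i)"
      for u :: "_ \<Rightarrow> real^'n"
    proof -
      have "norm (x, y) ^ 2 = (\<Sum>i\<in>UNIV. (x $ i)\<^sup>2) + (\<Sum>i\<in>UNIV. (y $ i)\<^sup>2)" for x y :: "real^'n"
        by (simp add: norm_Pair norm_vec_def L2_set_def sum_nonneg)
      then show ?thesis using u square_integrable_snd by (simp add: square_integrable_def)
    qed
    have "\<mu> \<in> Gamma \<nu>"
    proof (rule GammaI[OF \<open>prob_space \<mu>\<close> \<mu>sets])
      have "(\<lambda>p. norm p ^ 2) \<in> borel_measurable (borel :: ((real^'n) \<times> (real^'n)) measure)"
        by (intro borel_measurable_continuous_onI continuous_intros)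
      from key[OF this sq[OF T2] sq[OF z2]] show "integrable \<mu> (\<lambda>p. norm p ^ 2)" by (rule conjunct1)
    next
      show "distr \<mu> borel snd = \<nu>"
        unfolding second_marginal[symmetric]
      proof (rule measure_eqI)
        fix A assume "A \<in> sets (distr \<mu> borel (snd :: (real^'n) \<times> (real^'n) \<Rightarrow> _))"
        then have A: "A \<in> sets borel" by simp
        have snd\<mu>: "snd \<in> borel_measurable \<mu>" using sndB measurable_cong_sets[OF \<mu>sets refl] by blast
        have ind: "indicator (snd -` A) = (\<lambda>p. indicator A (snd p) :: real)" for A :: "(real^'n) set"
          by (auto simp: indicator_def)
        have sp: "space \<mu> = UNIV" using sets_eq_imp_space_eq[OF \<mu>sets] by simp
        have gB: "(\<lambda>p. indicator A (snd p) :: real) \<in> borel_measurable (borel :: ((real^'n) \<times> (real^'n)) measure)"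
          by (rule measurable_compose[OF sndB]) (use A in simp)
        have gI: "integrable \<gamma> (\<lambda>p. indicator A (snd p) :: real)"
          by (rule square_integrable_imp_integrable[OF square_integrable_bounded[OF borel_measurable_plan[OF gB], of 1]])
            (simp add: indicator_def)
        have "(\<integral>p. indicator A (snd p) \<partial>\<mu>) = (\<integral>p. (1 - \<theta> p) * indicator A (snd p) + \<theta> p * indicator A (snd p) \<partial>\<gamma>)"
          using key[OF gB] gI by simp
        also have "\<dots> = (\<integral>p. indicator A (snd p) \<partial>\<gamma>)"
          by (rule Bochner_Integration.integral_cong) (simp_all add: algebra_simps)
        finally have "measure \<mu> (snd -` A) = measure \<gamma> (snd -` A)"
          by (simp add: ind[symmetric] sp)
        then show "emeasure (distr \<mu> borel snd) A = emeasure (distr \<gamma> borel snd) A"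
          using A snd\<mu> by (simp add: emeasure_distr sp \<mu>.emeasure_eq_measure emeasure_eq_measure)
      qed simp
    next
      fix i and A :: "(real^'n) set" assume A: "A \<in> sets borel"
      let ?g = "\<lambda>p::(real^'n) \<times> (real^'n). indicator A (fst p) * (snd p $ i - fst p $ i) :: real"
      have gB: "?g \<in> borel_measurable borel"
      proof (rule borel_measurable_times)
        show "(\<lambda>p. indicator A (fst p) :: real) \<in> borel_measurable (borel :: ((real^'n) \<times> (real^'n)) measure)"
          by (rule measurable_compose[OF fstB]) (use A in simp)
      qed (intro borel_measurable_continuous_onI continuous_intros)
      have iF: "(\<lambda>p. indicator A (T p) :: real) \<in> borel_measurable F"
        by (rule measurable_compose[OF TF]) (use A in simp)
      have i2: "square_integrable \<gamma> (\<lambda>p. indicator A (T p) :: real)"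
        by (rule square_integrable_bounded[OF measurable_from_subalg[OF subalg iF], of 1]) (simp add: indicator_def)
      have g1: "integrable \<gamma> (\<lambda>p. ?g (T p, snd p))"
        using square_integrable_mult[OF i2 square_integrable_diff[OF square_integrable_snd T2]] by simp
      have g2: "integrable \<gamma> (\<lambda>p. ?g (z, snd p))"
        using square_integrable_imp_integrable[OF square_integrable_snd[of i]] by simp
      have wY: "integrable \<gamma> (\<lambda>p. w p * snd p $ i)" by (rule square_integrable_mult[OF w2 square_integrable_snd])
      have "(\<integral>p. ?g p \<partial>\<mu>) = (\<integral>p. (1 - \<theta> p) * ?g (T p, snd p) + \<theta> p * ?g (z, snd p) \<partial>\<gamma>)"
        using key[OF gB g1 g2] by (rule conjunct2)
      \<comment> \<open>The part sent to T vanishes by \<open>test\<close>; the part sent to z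
        vanishes because z is the w-weighted mean of y.\<close>
      also have "\<dots> = (\<integral>p. indicator A (T p) * ((1 - \<delta> * w p) * (snd p $ i - T p $ i))
          + \<delta> * indicator A z * (w p * snd p $ i) - \<delta> * indicator A z * z $ i * w p \<partial>\<gamma>)"
        by (rule Bochner_Integration.integral_cong) (simp_all add: \<theta>_def algebra_simps)
      also have "\<dots> = 0" using test[OF i2 iF, of i] wY iw by (simp add: z w1)
      finally show "(\<integral>p. ?g p \<partial>\<mu>) = 0" .
    qed
    then interpret \<mu>: form_plan S \<nu> \<mu>
      by (intro form_plan.intro nondegenerate_form_axioms martingale_plan.intro)
    have le: "plan_value S \<mu> \<le> plan_value S \<gamma>"
      using opt \<open>\<mu> \<in> Gamma \<nu>\<close> unfolding optimal_plan_def by blast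
    have qi: "integrable \<gamma> (\<lambda>p. quad (u p))" if u: "\<And>i. square_integrable \<gamma> (\<lambda>p. u p $ i)"
      for u :: "_ \<Rightarrow> real^'n"
    proof -
      have "integrable \<gamma> (\<lambda>p. B (u p) (u p))" unfolding B_component_sum
        by (intro Bochner_Integration.integrable_sum square_integrable_mult square_integrable_form u)
      then show ?thesis by (simp add: quad_def)
    qed
    have quB: "(\<lambda>p. quad (fst p)) \<in> borel_measurable (borel :: ((real^'n) \<times> (real^'n)) measure)"
      by (intro borel_measurable_continuous_onI continuous_intros)
    have "plan_value S \<mu> = (\<integral>p. quad (fst p) \<partial>\<mu>)" by (rule \<mu>.plan_value_eq)
    also have "\<dots> = (\<integral>p. (1 - \<theta> p) * quad (T p) + \<theta> p * quad z \<partial>\<gamma>)"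
      using key[OF quB] qi[OF T2] by simp
    \<comment> \<open>Expanding \<open>quad (T p)\<close> around the old point, the term linear in T
      is written through \<open>snd p - T p\<close>, which has weighted conditional mean 0. Only
      terms of order delta from w and of order delta squared from k survive.\<close>
    also have "\<dots> = (\<integral>p. minorant (fst p) (snd p) - \<delta> * (w p * minorant (fst p) (snd p))
        - (\<Sum>i\<in>UNIV. (S *v fst p) $ i * ((1 - \<delta> * w p) * (snd p $ i - T p $ i)))
        + \<delta>\<^sup>2 * ((1 - \<theta> p) * quad (k p)) + \<delta> * quad z * w p \<partial>\<gamma>)"
    proof (rule Bochner_Integration.integral_cong[OF refl])
      fix p :: "(real^'n) \<times> (real^'n)"
      have "(\<Sum>i\<in>UNIV. (S *v fst p) $ i * ((1 - \<delta> * w p) * (snd p $ i - T p $ i)))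
          = (1 - \<delta> * w p) * B (fst p) (snd p - T p)"
        by (simp add: B_component_sum sum_distrib_left mult_ac)
      moreover have "quad (T p) = minorant (fst p) (snd p) - B (fst p) (snd p - T p) + \<delta>\<^sup>2 * quad (k p)"
        by (simp add: T_def minorant_def quad_def B_simps B_commute[of "k p" "fst p"] power2_eq_square field_simps)
      ultimately show "(1 - \<theta> p) * quad (T p) + \<theta> p * quad z = minorant (fst p) (snd p)
        - \<delta> * (w p * minorant (fst p) (snd p))
        - (\<Sum>i\<in>UNIV. (S *v fst p) $ i * ((1 - \<delta> * w p) * (snd p $ i - T p $ i)))
        + \<delta>\<^sup>2 * ((1 - \<theta> p) * quad (k p)) + \<delta> * quad z * w p"
        by (simp add: \<theta>_def) (simp add: algebra_simps)
    qed
    also have "\<dots> = plan_value S \<gamma> - \<delta> * (\<integral>p. w p * minorant (fst p) (snd p) \<partial>\<gamma>)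
        + \<delta>\<^sup>2 * (\<integral>p. (1 - \<theta> p) * quad (k p) \<partial>\<gamma>) + \<delta> * quad z"
    proof -
      have SF: "(\<lambda>p. (S *v fst p) $ i) \<in> borel_measurable F" for i
        by (intro fst_comp_measurable_F borel_measurable_continuous_onI continuous_intros
            linear_continuous_on matrix_vector_mul_bounded_linear)
      note t = test[OF square_integrable_form_fst SF]
      have J1: "integrable \<gamma> (\<lambda>p. w p * minorant (fst p) (snd p))"
        by (rule integrable_bounded_mult[OF integrable_minorant w wK'])
      have J2: "integrable \<gamma> (\<lambda>p. (1 - \<theta> p) * quad (k p))"
        by (rule integrable_bounded_mult[OF qi[OF k2] _ \<theta>abs(1)]) simp
      have J3: "integrable \<gamma> (\<lambda>p. \<Sum>i\<in>UNIV. (S *v fst p) $ i * ((1 - \<delta> * w p) * (snd p $ i - T p $ i)))"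
        by (intro Bochner_Integration.integrable_sum t(2))
      have J4: "(\<integral>p. (\<Sum>i\<in>UNIV. (S *v fst p) $ i * ((1 - \<delta> * w p) * (snd p $ i - T p $ i))) \<partial>\<gamma>) = 0"
        by (subst Bochner_Integration.integral_sum[OF t(2)]) (simp only: t(1) sum.neutral_const)
      show ?thesis using J1 J2 J3 J4 integrable_minorant iw by (simp add: integral_minorant w1)
    qed
    finally have main: "\<delta> * quad z \<le> \<delta> * (\<integral>p. w p * minorant (fst p) (snd p) \<partial>\<gamma>)
        + \<delta>\<^sup>2 * - (\<integral>p. (1 - \<theta> p) * quad (k p) \<partial>\<gamma>)"
      using le by simp
    have "- (\<integral>p. (1 - \<theta> p) * quad (k p) \<partial>\<gamma>) \<le> R"
    proof -
      have "- ((1 - \<theta> p) * quad (k p)) \<le> 2 * C * (\<Sum>i\<in>UNIV. (c i p)\<^sup>2)" for p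
      proof -
        have "- ((1 - \<theta> p) * quad (k p)) \<le> \<bar>(1 - \<theta> p) * quad (k p)\<bar>" by (rule abs_ge_minus_self)
        also have "\<dots> = \<bar>1 - \<theta> p\<bar> * \<bar>quad (k p)\<bar>" by (rule abs_mult)
        also have "\<dots> \<le> 1 * \<bar>quad (k p)\<bar>" by (intro mult_right_mono \<theta>abs(1) abs_ge_zero)
        also have "\<dots> \<le> C / 2 * norm (k p) ^ 2"
          using C[of "k p" "k p"] by (simp add: quad_def power2_eq_square mult.assoc)
        also have "norm (k p) ^ 2 = (\<Sum>i\<in>UNIV. (s p * c i p)\<^sup>2)"
          by (simp add: norm_vec_def L2_set_def sum_nonneg k_def)
        also have "\<dots> \<le> (\<Sum>i\<in>UNIV. 4 * (c i p)\<^sup>2)"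
          using power_mono[OF s(2)[of p] s(1)[of p], of 2]
          by (intro sum_mono) (simp add: power_mult_distrib mult_right_mono)
        finally show ?thesis using C0 by (simp add: sum_distrib_left[symmetric])
      qed
      then have "(\<integral>p. - ((1 - \<theta> p) * quad (k p)) \<partial>\<gamma>) \<le> (\<integral>p. 2 * C * (\<Sum>i\<in>UNIV. (c i p)\<^sup>2) \<partial>\<gamma>)"
        using integrable_bounded_mult[OF qi[OF k2] _ \<theta>abs(1)] c2
        by (intro integral_mono) (simp_all add: square_integrable_def)
      also have "\<dots> = R" using c2 by (simp add: R_def square_integrable_def)
      finally show ?thesis by simp
    qed
    from mult_left_mono[OF this zero_le_power2[of \<delta>]] main
    have "\<delta> * quad z \<le> \<delta> * (\<integral>p. w p * minorant (fst p) (snd p) \<partial>\<gamma>) + \<delta>\<^sup>2 * R" by linarith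
    then have "\<delta> * quad z \<le> \<delta> * ((\<integral>p. w p * minorant (fst p) (snd p) \<partial>\<gamma>) + \<delta> * R)"
      by (simp add: algebra_simps power2_eq_square)
    then show ?thesis using \<delta>(1) by simp
  qed
  let ?L = "\<integral>p. w p * minorant (fst p) (snd p) \<partial>\<gamma>"
  have "((\<lambda>\<delta>. ?L + \<delta> * R) \<longlongrightarrow> ?L + 0 * R) (at_right 0)" by (intro tendsto_intros)
  moreover have "eventually (\<lambda>\<delta>. quad z \<le> ?L + \<delta> * R) (at_right 0)"
    using eventually_at_right_real[of 0 "1 / (2 * K)"] K0
    by (auto elim!: eventually_mono intro!: ineq)
  ultimately have "quad z \<le> ?L + 0 * R" by (intro tendsto_lowerbound[of _ _ "at_right 0"]) auto
  then show ?thesis by simp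
qed

end

section \<open>Duality\<close>

lemma AE_mem_msupp:
  fixes M :: "'a::second_countable_topology measure"
  assumes "sets M = sets borel"
  shows "AE p in M. p \<in> msupp M"
proof -
  obtain \<B> :: "'a set set" where B: "countable \<B>" "topological_basis \<B>"
    using ex_countable_basis by (elim exE conjE)
  \<comment> \<open>A point off the support has a null basic neighbourhood, and a countable basis
    offers only countably many of these.\<close>
  let ?N = "\<Union>V\<in>{V\<in>\<B>. emeasure M V = 0}. V"
  have "?N \<in> null_sets M"
  proof (rule null_sets_UN')
    show "countable {V\<in>\<B>. emeasure M V = 0}" using B(1) by (rule countable_subset[rotated]) simp
    fix V assume V: "V \<in> {V\<in>\<B>. emeasure M V = 0}"
    then have "open V" using B(2) by (simp add: topological_basis_open)
    then show "V \<in> null_sets M" using V assms by (simp add: null_setsI)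
  qed
  moreover have "{p\<in>space M. \<not> p \<in> msupp M} \<subseteq> ?N"
  proof
    fix p assume "p \<in> {p\<in>space M. \<not> p \<in> msupp M}"
    then obtain U where U: "open U" "p \<in> U" "emeasure M U = 0"
      by (auto simp: msupp_def not_gr_zero)
    obtain V where V: "V \<in> \<B>" "p \<in> V" "V \<subseteq> U"
      using topological_basisE[OF B(2) U(1,2)] by blast
    have "emeasure M V \<le> emeasure M U" using U(1) assms by (intro emeasure_mono V) simp
    then show "p \<in> ?N" using U(3) V by auto
  qed
  ultimately show ?thesis by (rule AE_I')
qed

lemma msupp_subset_closed:
  assumes "sets M = sets borel" "closed C" "AE p in M. p \<in> C"
  shows "msupp M \<subseteq> C"
proof (rule subsetI, rule ccontr)
  fix p assume p: "p \<in> msupp M" "p \<notin> C"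
  have "open (- C)" using assms(2) by (simp add: open_closed)
  then have "emeasure M (- C) > 0" using p unfolding msupp_def by simp
  moreover have "emeasure M (- C) = 0"
  proof -
    have sp: "space M = UNIV" using sets_eq_imp_space_eq[OF assms(1)] by simp
    have "- C \<in> sets M" using assms(1) \<open>open (- C)\<close> by simp
    then show ?thesis using AE_iff_measurable[of "- C" M "\<lambda>p. p \<in> C"] assms(3) by (simp add: sp Compl_eq)
  qed
  ultimately show False by simp
qed

section \<open>Comparing the extended integral with Bochner integrals\<close>

lemma integral_eq_nn_ereal:
  assumes "integrable M g"
  shows "ereal (\<integral>x. g x \<partial>M) = enn2ereal (\<integral>\<^sup>+x. ennreal (g x) \<partial>M) - enn2ereal (\<integral>\<^sup>+x. ennreal (- g x) \<partial>M)"
proof -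
  have fin: "(\<integral>\<^sup>+x. ennreal (g x) \<partial>M) \<noteq> \<infinity>" "(\<integral>\<^sup>+x. ennreal (- g x) \<partial>M) \<noteq> \<infinity>"
    using assms by (auto simp: real_integrable_def)
  have e: "enn2ereal a = ereal (enn2real a)" if "a \<noteq> \<infinity>" for a
    using that by (cases a) (auto simp: enn2ereal_ennreal)
  show ?thesis by (simp add: real_lebesgue_integral_def[OF assms] e[OF fin(1)] e[OF fin(2)])
qed

text \<open>Positive and negative parts are compared separately, so f may take infinite values. This
  is how \<open>psiG\<close> is bounded below by integrable functions.\<close>

lemma ext_integral_ge:
  assumes "integrable M g" "AE x in M. ereal (g x) \<le> f x"
  shows "ereal (\<integral>x. g x \<partial>M) \<le> ext_integral M f"
  unfolding ext_integral_def integral_eq_nn_ereal[OF assms(1)]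
proof (rule ereal_minus_mono)
  show "enn2ereal (\<integral>\<^sup>+x. ennreal (g x) \<partial>M) \<le> enn2ereal (\<integral>\<^sup>+x. e2ennreal (f x) \<partial>M)"
    unfolding less_eq_ennreal.rep_eq[symmetric]
  proof (rule nn_integral_mono_AE)
    show "AE x in M. ennreal (g x) \<le> e2ennreal (f x)"
      using assms(2) by eventually_elim (simp add: e2ennreal_mono flip: e2ennreal_ereal)
  qed
  show "enn2ereal (\<integral>\<^sup>+x. e2ennreal (- f x) \<partial>M) \<le> enn2ereal (\<integral>\<^sup>+x. ennreal (- g x) \<partial>M)"
    unfolding less_eq_ennreal.rep_eq[symmetric]
  proof (rule nn_integral_mono_AE)
    show "AE x in M. e2ennreal (- f x) \<le> ennreal (- g x)"
      using assms(2) by eventually_elim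
        (simp add: e2ennreal_mono ereal_minus_le_minus flip: e2ennreal_ereal uminus_ereal.simps(1))
  qed
qed

lemma ext_integral_le:
  assumes "integrable M g" "AE x in M. f x \<le> ereal (g x)"
  shows "ext_integral M f \<le> ereal (\<integral>x. g x \<partial>M)"
  unfolding ext_integral_def integral_eq_nn_ereal[OF assms(1)]
proof (rule ereal_minus_mono)
  show "enn2ereal (\<integral>\<^sup>+x. e2ennreal (f x) \<partial>M) \<le> enn2ereal (\<integral>\<^sup>+x. ennreal (g x) \<partial>M)"
    unfolding less_eq_ennreal.rep_eq[symmetric]
  proof (rule nn_integral_mono_AE)
    show "AE x in M. e2ennreal (f x) \<le> ennreal (g x)"
      using assms(2) by eventually_elim (simp add: e2ennreal_mono flip: e2ennreal_ereal)
  qed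
  show "enn2ereal (\<integral>\<^sup>+x. ennreal (- g x) \<partial>M) \<le> enn2ereal (\<integral>\<^sup>+x. e2ennreal (- f x) \<partial>M)"
    unfolding less_eq_ennreal.rep_eq[symmetric]
  proof (rule nn_integral_mono_AE)
    show "AE x in M. ennreal (- g x) \<le> e2ennreal (- f x)"
      using assms(2) by eventually_elim
        (simp add: e2ennreal_mono ereal_minus_le_minus flip: e2ennreal_ereal uminus_ereal.simps(1))
  qed
qed

lemma ext_integral_distr:
  assumes [measurable]: "T \<in> measurable M N" "f \<in> borel_measurable N"
  shows "ext_integral (distr M N T) f = ext_integral M (\<lambda>x. f (T x))"
  unfolding ext_integral_def by (simp add: nn_integral_distr)

text \<open>The excess \<open>max (f x) (g x) - f x\<close> is nonnegative with nonpositive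
  integral. Almost sure inequalities are extracted in this way from the absence of a duality
  gap.\<close>

lemma AE_le_of_integral_max_le:
  assumes f: "integrable M f" and g: "integrable M g"
    and le: "(\<integral>x. max (f x) (g x) \<partial>M) \<le> (\<integral>x. f x \<partial>M)"
  shows "AE x in M. g x \<le> (f x :: real)"
proof -
  have i: "integrable M (\<lambda>x. max (f x) (g x) - f x)" using f g by simp
  have "(\<integral>x. max (f x) (g x) - f x \<partial>M) \<le> 0" using f g le by simp
  moreover have "0 \<le> (\<integral>x. max (f x) (g x) - f x \<partial>M)" by (intro integral_nonneg_AE AE_I2) simp
  ultimately have "(\<integral>x. max (f x) (g x) - f x \<partial>M) = 0" by (rule antisym)
  then have "AE x in M. max (f x) (g x) - f x = 0"
    using integral_nonneg_eq_0_iff_AE[OF i] by simp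
  then show ?thesis by eventually_elim simp
qed

section \<open>The functions psi_G and the argmax sets\<close>

context nondegenerate_form begin

lemma psiG_eq: "psiG S G y = (SUP x\<in>G. ereal (minorant x y))"
  by (simp add: psiG_def minorant_def quad_def)

lemma PG_eq: "PG S G y = {x\<in>G. \<forall>x'\<in>G. minorant x' y \<le> minorant x y}"
  by (simp add: PG_def minorant_def quad_def)

lemma minorant_le_psiG: "x \<in> G \<Longrightarrow> ereal (minorant x y) \<le> psiG S G y"
  unfolding psiG_eq by (rule SUP_upper)

lemma psiG_le_iff: "psiG S G y \<le> ereal c \<longleftrightarrow> (\<forall>x\<in>G. minorant x y \<le> c)"
  by (simp add: psiG_eq SUP_le_iff)

lemma psiG_PG: "x \<in> PG S G y \<Longrightarrow> psiG S G y = ereal (minorant x y)"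
  using minorant_le_psiG[of x G y] psiG_le_iff[of G y "minorant x y"] by (auto simp: PG_eq intro: antisym)

lemma mem_maxS_monotone_iff_minorant:
  assumes "G \<in> maxS_monotone S"
  shows "x \<in> G \<longleftrightarrow> (\<forall>y\<in>G. minorant y x \<le> quad x)"
proof -
  have *: "minorant y x \<le> quad x \<longleftrightarrow> 0 \<le> quad (x - y)" for y
    unfolding minorant_eq quad_diff_commute[of y x] by simp
  show ?thesis by (subst mem_maxS_monotone_iff[OF assms]) (simp only: *)
qed

text \<open>If the supremum stayed below \<open>quad x\<close>, then x would be related to all of G,
  hence in G, where its own minorant attains \<open>quad x\<close>.\<close>

lemma quad_le_psiG:
  assumes "G \<in> maxS_monotone S" shows "ereal (quad x) \<le> psiG S G x"
proof (rule ccontr)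
  assume "\<not> ereal (quad x) \<le> psiG S G x"
  then have "psiG S G x < ereal (quad x)" by simp
  then have "\<forall>y\<in>G. minorant y x \<le> quad x"
    by (simp only: psiG_le_iff[symmetric] less_imp_le)
  then have "x \<in> G" by (rule mem_maxS_monotone_iff_minorant[OF assms, THEN iffD2])
  from minorant_le_psiG[OF this, of x] \<open>psiG S G x < ereal (quad x)\<close> show False by simp
qed

lemma mem_PG_self: "G \<in> maxS_monotone S \<Longrightarrow> x \<in> G \<Longrightarrow> x \<in> PG S G x"
  using mem_maxS_monotone_iff_minorant[of G x] by (simp add: PG_eq del: ball_simps)

lemma minorant_dense_le:
  assumes "D \<subseteq> G" "G \<subseteq> closure D" "\<And>d. d \<in> D \<Longrightarrow> minorant d y \<le> c" "x \<in> G"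
  shows "minorant x y \<le> c"
proof -
  have "closed {x. minorant x y \<le> c}" by (intro closed_Collect_le continuous_intros)
  then have "closure D \<subseteq> {x. minorant x y \<le> c}" using assms(3) by (intro closure_minimal) auto
  then show ?thesis using assms(2,4) by auto
qed

lemma dense_sequence:
  assumes "G \<noteq> {}"
  obtains d :: "nat \<Rightarrow> real^'n" where "range d \<subseteq> G" "G \<subseteq> closure (range d)"
proof -
  obtain D where D: "countable D" "D \<subseteq> G" "G \<subseteq> closure D" using separable[of G] by blast
  then have "D \<noteq> {}" using assms by auto
  then have "range (from_nat_into D) = D" using D(1) by (rule range_from_nat_into)
  then show ?thesis using that[of "from_nat_into D"] D by simp
qed

lemma psiG_dense:
  fixes d :: "nat \<Rightarrow> real^'n"
  assumes "range d \<subseteq> G" "G \<subseteq> closure (range d)"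
  shows "psiG S G y = (SUP k. ereal (minorant (d k) y))"
proof (rule antisym)
  show "psiG S G y \<le> (SUP k. ereal (minorant (d k) y))"
  proof (cases "SUP k. ereal (minorant (d k) y)")
    case (real c)
    have "minorant (d k) y \<le> c" for k
      using SUP_upper[of k UNIV "\<lambda>k. ereal (minorant (d k) y)"] real by simp
    then have "minorant x y \<le> c" if "x \<in> G" for x
      using minorant_dense_le[OF assms _ that] by auto
    then show ?thesis using real by (simp add: psiG_le_iff)
  next
    case MInf
    then have "ereal (minorant (d 0) y) \<le> -\<infinity>" using SUP_upper[of 0 UNIV "\<lambda>k. ereal (minorant (d k) y)"] by simp
    then show ?thesis by simp
  qed simp
  show "(SUP k. ereal (minorant (d k) y)) \<le> psiG S G y"
    using assms(1) by (intro SUP_least minorant_le_psiG) auto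
qed

lemma borel_measurable_psiG:
  assumes "G \<noteq> {}" shows "psiG S G \<in> borel_measurable borel"
proof -
  obtain d :: "nat \<Rightarrow> real^'n" where d: "range d \<subseteq> G" "G \<subseteq> closure (range d)"
    by (rule dense_sequence[OF assms])
  have "(\<lambda>y. minorant (d k) y) \<in> borel_measurable borel" for k
    by (intro borel_measurable_continuous_onI continuous_intros)
  then have "(\<lambda>y. SUP k. ereal (minorant (d k) y)) \<in> borel_measurable borel" by measurable
  then show ?thesis using psiG_dense[OF d] by (simp cong: measurable_cong)
qed

text \<open>Closedness is what makes membership on the support and membership almost everywhere the
  same condition.\<close>

lemma closed_graph_PG:
  assumes "closed G" shows "closed {p. fst p \<in> PG S G (snd p)}"
proof -
  have "{p. fst p \<in> PG S G (snd p)} = {p. fst p \<in> G} \<inter> (\<Inter>x'\<in>G. {p. minorant x' (snd p) \<le> minorant (fst p) (snd p)})"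
    by (auto simp: PG_eq)
  moreover have "closed {p::(real^'n) \<times> (real^'n). fst p \<in> G}"
    using closed_vimage_fst[OF assms] by (simp add: vimage_def)
  moreover have "closed {p. minorant x' (snd p) \<le> minorant (fst p) (snd p)}" for x'
    by (intro closed_Collect_le continuous_intros)
  ultimately show ?thesis by (simp add: closed_Int closed_INT)
qed

text \<open>A running argmax among d 0, ..., d n: finitely many values, measurable in y, and its
  \<open>minorant\<close> value increases to \<open>psiG\<close> when d is dense in G.\<close>

fun selection :: "(nat \<Rightarrow> real^'n) \<Rightarrow> nat \<Rightarrow> real^'n \<Rightarrow> real^'n" where
  "selection d 0 y = d 0"
| "selection d (Suc n) y =
    (if minorant (selection d n y) y < minorant (d (Suc n)) y then d (Suc n) else selection d n y)"

lemma selection_in: "selection d n y \<in> d ` {..n}"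
  by (induction n) (auto simp: atMost_Suc)

lemma selection_max: "k \<le> n \<Longrightarrow> minorant (d k) y \<le> minorant (selection d n y) y"
  by (induction n) (auto simp: le_Suc_eq)

lemma selection_measurable: "selection d n \<in> borel_measurable borel"
proof (induction n)
  case (Suc n)
  have "(\<lambda>y. minorant (selection d n y) y) \<in> borel_measurable borel"
    by (rule borel_measurable_continuous_Pair[OF Suc measurable_ident_sets[OF refl], of minorant])
      (intro continuous_intros)
  moreover have "(\<lambda>y. minorant (d (Suc n)) y) \<in> borel_measurable borel"
    by (intro borel_measurable_continuous_onI continuous_intros)
  ultimately have "{y. minorant (selection d n y) y < minorant (d (Suc n)) y} \<in> sets borel"
    using borel_measurable_less[of "\<lambda>y. minorant (selection d n y) y" borel "\<lambda>y. minorant (d (Suc n)) y"] by simp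
  then show ?case unfolding selection.simps using Suc by (intro measurable_If) simp_all
qed simp

end

section \<open>Conditional Jensen inequality and weak duality\<close>

context form_plan begin

text \<open>For a point u chosen from x alone, \<open>minorant u\<close> is affine in y, so
  replacing y by its conditional mean x does not change the integral.\<close>

lemma square_integrable_test:
  fixes u :: "(real^'n) \<times> (real^'n) \<Rightarrow> real^'n"
  assumes uF: "u \<in> borel_measurable F" and u2: "\<And>i. square_integrable \<gamma> (\<lambda>p. u p $ i)"
  shows "integrable \<gamma> (\<lambda>p. minorant (u p) (fst p))"
    and "integrable \<gamma> (\<lambda>p. minorant (u p) (snd p))"
    and "(\<integral>p. minorant (u p) (snd p) \<partial>\<gamma>) = (\<integral>p. minorant (u p) (fst p) \<partial>\<gamma>)"
proof -
  note Su2 = square_integrable_form[OF u2]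
  have SF: "(\<lambda>p. (S *v u p) $ i) \<in> borel_measurable F" for i
    by (rule measurable_compose[OF uF])
      (intro borel_measurable_continuous_onI continuous_intros linear_continuous_on matrix_vector_mul_bounded_linear)
  have iq: "integrable \<gamma> (\<lambda>p. quad (u p))"
    unfolding quad_def B_component_sum
    by (intro Bochner_Integration.integrable_divide Bochner_Integration.integrable_sum square_integrable_mult Su2 u2)
  have i1: "integrable \<gamma> (\<lambda>p. B (u p) (fst p))" and i2: "integrable \<gamma> (\<lambda>p. B (u p) (snd p))"
    unfolding B_component_sum
    by (intro Bochner_Integration.integrable_sum square_integrable_mult Su2 square_integrable_fst square_integrable_snd)+
  show I1: "integrable \<gamma> (\<lambda>p. minorant (u p) (fst p))" and I2: "integrable \<gamma> (\<lambda>p. minorant (u p) (snd p))"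
    unfolding minorant_def by (intro Bochner_Integration.integrable_diff i1 i2 iq)+
  have "(\<integral>p. minorant (u p) (snd p) \<partial>\<gamma>) - (\<integral>p. minorant (u p) (fst p) \<partial>\<gamma>)
      = (\<integral>p. (\<Sum>i\<in>UNIV. (S *v u p) $ i * (snd p $ i - fst p $ i)) \<partial>\<gamma>)"
    by (subst Bochner_Integration.integral_diff[symmetric, OF I2 I1])
      (simp add: minorant_def B_component_sum right_diff_distrib sum_subtractf)
  also have "\<dots> = (\<Sum>i\<in>UNIV. \<integral>p. (S *v u p) $ i * (snd p $ i - fst p $ i) \<partial>\<gamma>)"
    by (intro Bochner_Integration.integral_sum square_integrable_mult square_integrable_diff
        Su2 square_integrable_fst square_integrable_snd)
  also have "\<dots> = 0" by (intro sum.neutral ballI martingale_test Su2 SF)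
  finally show "(\<integral>p. minorant (u p) (snd p) \<partial>\<gamma>) = (\<integral>p. minorant (u p) (fst p) \<partial>\<gamma>)" by simp
qed

lemma square_integrable_components:
  fixes u :: "(real^'n) \<times> (real^'n) \<Rightarrow> real^'n"
  assumes uF: "u \<in> borel_measurable F" and bnd: "\<And>p. norm (u p) \<le> K"
  shows "square_integrable \<gamma> (\<lambda>p. u p $ i)"
proof (rule square_integrable_bounded)
  have "(\<lambda>p. u p $ i) \<in> borel_measurable F"
    by (rule measurable_compose[OF uF]) (intro borel_measurable_continuous_onI continuous_intros)
  then show "(\<lambda>p. u p $ i) \<in> borel_measurable \<gamma>" by (rule measurable_from_subalg[OF subalg])
  show "AE p in \<gamma>. \<bar>u p $ i\<bar> \<le> K" by (rule AE_I2) (rule order_trans[OF component_le_norm_cart bnd])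
qed

lemma ext_integral_second_marginal:
  "G \<noteq> {} \<Longrightarrow> ext_integral \<nu> (psiG S G) = ext_integral \<gamma> (\<lambda>p. psiG S G (snd p))"
  using ext_integral_distr[OF snd_measurable borel_measurable_psiG] by (simp add: second_marginal)

text \<open>Jensen's inequality for \<open>psiG\<close>, stated through an integrable lower bound u
  because \<open>psiG\<close> may be infinite. Affine functions chosen by \<open>selection\<close>
  at x have the same mean at x and at y, and at y they lie below \<open>psiG\<close>; their values
  at x increase to \<open>psiG\<close>.\<close>

lemma ext_integral_psiG_ge:
  assumes ne: "G \<noteq> {}" and u: "integrable \<gamma> u" and le: "AE p in \<gamma>. ereal (u p) \<le> psiG S G (fst p)"
  shows "ereal (\<integral>p. u p \<partial>\<gamma>) \<le> ext_integral \<nu> (psiG S G)"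
proof -
  obtain d :: "nat \<Rightarrow> real^'n" where d: "range d \<subseteq> G" "G \<subseteq> closure (range d)"
    by (rule dense_sequence[OF ne])
  define \<sigma> where "\<sigma> n p = selection d n (fst p)" for n and p :: "(real^'n) \<times> (real^'n)"
  have \<sigma>F: "\<sigma> n \<in> borel_measurable F" for n
    unfolding \<sigma>_def by (rule fst_comp_measurable_F[OF selection_measurable])
  have \<sigma>b: "norm (\<sigma> n p) \<le> (\<Sum>k\<le>n. norm (d k))" for n p
  proof -
    obtain k where "k \<le> n" "\<sigma> n p = d k" using selection_in[of d n "fst p"] by (auto simp: \<sigma>_def)
    then show ?thesis using member_le_sum[of k "{..n}" "\<lambda>k. norm (d k)"] by simp
  qed
  have \<sigma>G: "\<sigma> n p \<in> G" for n p using selection_in[of d n "fst p"] d(1) by (auto simp: \<sigma>_def)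
  note bt = square_integrable_test[OF \<sigma>F square_integrable_components[OF \<sigma>F \<sigma>b]]
  define h where "h n p = minorant (\<sigma> n p) (fst p)" for n p
  have hi: "integrable \<gamma> (h n)" for n unfolding h_def by (rule bt(1))
  have uM: "u \<in> borel_measurable \<gamma>" using u by (rule borel_measurable_integrable)
  have hM: "h n \<in> borel_measurable \<gamma>" for n using hi by (rule borel_measurable_integrable)
  have step: "ereal (\<integral>p. min (u p) (h n p) \<partial>\<gamma>) \<le> ext_integral \<nu> (psiG S G)" for n
  proof -
    have "(\<integral>p. min (u p) (h n p) \<partial>\<gamma>) \<le> (\<integral>p. h n p \<partial>\<gamma>)"
      by (intro integral_mono integrable_min u hi) simp
    also have "\<dots> = (\<integral>p. minorant (\<sigma> n p) (snd p) \<partial>\<gamma>)" unfolding h_def by (rule bt(3)[symmetric])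
    finally have "ereal (\<integral>p. min (u p) (h n p) \<partial>\<gamma>) \<le> ereal (\<integral>p. minorant (\<sigma> n p) (snd p) \<partial>\<gamma>)" by simp
    also have "\<dots> \<le> ext_integral \<nu> (psiG S G)"
      unfolding ext_integral_second_marginal[OF ne]
      by (intro ext_integral_ge bt(2) AE_I2 minorant_le_psiG \<sigma>G)
    finally show ?thesis .
  qed
  \<comment> \<open>Truncation at u bounds the sequence from above, and the value of the first
    selection bounds it from below, whence the dominating function.\<close>
  have "(\<lambda>n. \<integral>p. min (u p) (h n p) \<partial>\<gamma>) \<longlonglongrightarrow> (\<integral>p. u p \<partial>\<gamma>)"
  proof (rule integral_dominated_convergence[where w="\<lambda>p. \<bar>u p\<bar> + \<bar>h 0 p\<bar>"])
    show "integrable \<gamma> (\<lambda>p. \<bar>u p\<bar> + \<bar>h 0 p\<bar>)" using u hi by simp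
    show "(\<lambda>p. min (u p) (h n p)) \<in> borel_measurable \<gamma>" for n using uM hM by simp
    show "AE p in \<gamma>. norm (min (u p) (h n p)) \<le> \<bar>u p\<bar> + \<bar>h 0 p\<bar>" for n
    proof (rule AE_I2)
      fix p
      have "h 0 p \<le> h n p" using selection_max[of 0 n d "fst p"] by (simp add: h_def \<sigma>_def)
      then show "norm (min (u p) (h n p)) \<le> \<bar>u p\<bar> + \<bar>h 0 p\<bar>" by (auto simp: min_def abs_if)
    qed
    show "AE p in \<gamma>. (\<lambda>n. min (u p) (h n p)) \<longlonglongrightarrow> u p"
      using le
    proof eventually_elim
      fix p assume p: "ereal (u p) \<le> psiG S G (fst p)"
      show "(\<lambda>n. min (u p) (h n p)) \<longlonglongrightarrow> u p"
      proof (rule LIMSEQ_I)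
        fix r :: real assume r: "0 < r"
        then have "ereal (u p - r) < ereal (u p)" by simp
        also note p
        finally have "ereal (u p - r) < (SUP k. ereal (minorant (d k) (fst p)))" unfolding psiG_dense[OF d] .
        then obtain k where k: "u p - r < minorant (d k) (fst p)" unfolding less_SUP_iff by auto
        have "norm (min (u p) (h n p) - u p) < r" if "k \<le> n" for n
          using selection_max[OF that, of d "fst p"] k r by (simp add: h_def \<sigma>_def min_def)
        then show "\<exists>no. \<forall>n\<ge>no. norm (min (u p) (h n p) - u p) < r" by iprover
      qed
    qed
  qed (rule uM)
  then have "(\<lambda>n. ereal (\<integral>p. min (u p) (h n p) \<partial>\<gamma>)) \<longlonglongrightarrow> ereal (\<integral>p. u p \<partial>\<gamma>)" by simp
  then show ?thesis by (rule LIMSEQ_le_const2) (intro exI[of _ 0] allI impI step)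
qed

lemma weak_duality:
  assumes "G \<in> maxS_monotone S"
  shows "ereal (plan_value S \<gamma>) \<le> ext_integral \<nu> (psiG S G)"
  unfolding plan_value_eq
  by (intro ext_integral_psiG_ge maxS_monotone_nonempty[OF assms] integrable_quad_fst AE_I2 quad_le_psiG[OF assms])

lemma PG_supp_iff_AE:
  assumes "closed G"
  shows "(\<forall>(x, y)\<in>msupp \<gamma>. x \<in> PG S G y) \<longleftrightarrow> (AE p in \<gamma>. fst p \<in> PG S G (snd p))"
proof
  assume *: "\<forall>(x, y)\<in>msupp \<gamma>. x \<in> PG S G y"
  show "AE p in \<gamma>. fst p \<in> PG S G (snd p)"
    using AE_mem_msupp[OF sets_plan] by eventually_elim (use * in auto)
next
  assume "AE p in \<gamma>. fst p \<in> PG S G (snd p)"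
  then have "msupp \<gamma> \<subseteq> {p. fst p \<in> PG S G (snd p)}"
    by (intro msupp_subset_closed sets_plan closed_graph_PG assms) simp
  then show "\<forall>(x, y)\<in>msupp \<gamma>. x \<in> PG S G y" by auto
qed

lemma PG_imp_optimal:
  assumes G: "G \<in> maxS_monotone S" and PG: "AE p in \<gamma>. fst p \<in> PG S G (snd p)"
  shows "optimal_plan S \<nu> \<gamma> \<and> optimal_set S \<nu> G"
proof -
  have "ext_integral \<nu> (psiG S G) \<le> ereal (\<integral>p. minorant (fst p) (snd p) \<partial>\<gamma>)"
    unfolding ext_integral_second_marginal[OF maxS_monotone_nonempty[OF G]]
  proof (rule ext_integral_le[OF integrable_minorant])
    show "AE p in \<gamma>. psiG S G (snd p) \<le> ereal (minorant (fst p) (snd p))"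
      using PG by eventually_elim (simp add: psiG_PG)
  qed
  then have le: "ext_integral \<nu> (psiG S G) \<le> ereal (plan_value S \<gamma>)" by (simp add: integral_minorant)
  have "plan_value S \<gamma>' \<le> plan_value S \<gamma>" if "\<gamma>' \<in> Gamma \<nu>" for \<gamma>'
  proof -
    interpret \<gamma>': form_plan S \<nu> \<gamma>'
      by (intro form_plan.intro nondegenerate_form_axioms martingale_plan.intro that)
    show ?thesis using order_trans[OF \<gamma>'.weak_duality[OF G] le] by simp
  qed
  moreover have "ext_integral \<nu> (psiG S G) \<le> ext_integral \<nu> (psiG S G')" if "G' \<in> maxS_monotone S" for G'
    using order_trans[OF le weak_duality[OF that]] .
  ultimately show ?thesis using G plan by (simp add: optimal_plan_def optimal_set_def)
qed

section \<open>Complementary slackness and strong duality\<close>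

lemma integrable_minorant_const:
  "integrable \<gamma> (\<lambda>p. minorant x (fst p))" "integrable \<gamma> (\<lambda>p. minorant x (snd p))"
  using square_integrable_test(1,2)[of "\<lambda>_. x"] by (simp_all add: square_integrable_def)

text \<open>Zero gap forces equality at both stages of weak duality. The first gives x in G, since
  no \<open>minorant (d k)\<close> exceeds \<open>quad\<close> at x; the second gives optimality of
  x for y. Testing one d k at a time keeps all functions integrable, and density passes to the whole
  of G.\<close>

lemma PG_of_duality:
  assumes G: "G \<in> maxS_monotone S" and le: "ext_integral \<nu> (psiG S G) \<le> ereal (plan_value S \<gamma>)"
  shows "AE p in \<gamma>. fst p \<in> PG S G (snd p)"
proof -
  note ne = maxS_monotone_nonempty[OF G]
  obtain d :: "nat \<Rightarrow> real^'n" where d: "range d \<subseteq> G" "G \<subseteq> closure (range d)"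
    by (rule dense_sequence[OF ne])
  have dG: "d k \<in> G" for k using d(1) by auto
  have "AE p in \<gamma>. minorant (d k) (fst p) \<le> quad (fst p)" for k
  proof (rule AE_le_of_integral_max_le[OF integrable_quad_fst integrable_minorant_const(1)])
    have "ereal (\<integral>p. max (quad (fst p)) (minorant (d k) (fst p)) \<partial>\<gamma>) \<le> ext_integral \<nu> (psiG S G)"
    proof (rule ext_integral_psiG_ge[OF ne])
      show "AE p in \<gamma>. ereal (max (quad (fst p)) (minorant (d k) (fst p))) \<le> psiG S G (fst p)"
        using quad_le_psiG[OF G] minorant_le_psiG[OF dG] by (intro AE_I2) (simp add: max_def)
    qed (intro integrable_max integrable_quad_fst integrable_minorant_const)
    from order_trans[OF this le]
    show "(\<integral>p. max (quad (fst p)) (minorant (d k) (fst p)) \<partial>\<gamma>) \<le> (\<integral>p. quad (fst p) \<partial>\<gamma>)"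
      by (simp add: plan_value_eq)
  qed
  then have "AE p in \<gamma>. \<forall>k. minorant (d k) (fst p) \<le> quad (fst p)" by (simp add: AE_all_countable)
  then have X: "AE p in \<gamma>. fst p \<in> G"
  proof eventually_elim
    fix p :: "(real^'n) \<times> (real^'n)" assume k: "\<forall>k. minorant (d k) (fst p) \<le> quad (fst p)"
    have "minorant x (fst p) \<le> quad (fst p)" if "x \<in> G" for x
      by (rule minorant_dense_le[OF d _ that]) (use k in auto)
    then show "fst p \<in> G" using mem_maxS_monotone_iff_minorant[OF G] by blast
  qed
  \<comment> \<open>Here x in G is already needed: it places \<open>minorant (fst p) (snd p)\<close>
    below \<open>psiG\<close> at y.\<close>
  have "AE p in \<gamma>. minorant (d k) (snd p) \<le> minorant (fst p) (snd p)" for k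
  proof (rule AE_le_of_integral_max_le[OF integrable_minorant integrable_minorant_const(2)])
    have "ereal (\<integral>p. max (minorant (fst p) (snd p)) (minorant (d k) (snd p)) \<partial>\<gamma>) \<le> ext_integral \<nu> (psiG S G)"
      unfolding ext_integral_second_marginal[OF ne]
    proof (rule ext_integral_ge)
      show "AE p in \<gamma>. ereal (max (minorant (fst p) (snd p)) (minorant (d k) (snd p))) \<le> psiG S G (snd p)"
        using X by eventually_elim (simp add: max_def minorant_le_psiG dG)
    qed (intro integrable_max integrable_minorant integrable_minorant_const)
    from order_trans[OF this le]
    show "(\<integral>p. max (minorant (fst p) (snd p)) (minorant (d k) (snd p)) \<partial>\<gamma>) \<le> (\<integral>p. minorant (fst p) (snd p) \<partial>\<gamma>)"
      by (simp add: integral_minorant)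
  qed
  then have "AE p in \<gamma>. \<forall>k. minorant (d k) (snd p) \<le> minorant (fst p) (snd p)" by (simp add: AE_all_countable)
  with X show ?thesis
  proof eventually_elim
    fix p :: "(real^'n) \<times> (real^'n)"
    assume p: "fst p \<in> G" and k: "\<forall>k. minorant (d k) (snd p) \<le> minorant (fst p) (snd p)"
    have "minorant x (snd p) \<le> minorant (fst p) (snd p)" if "x \<in> G" for x
      by (rule minorant_dense_le[OF d _ that]) (use k in auto)
    then show "fst p \<in> PG S G (snd p)" using p by (simp add: PG_eq)
  qed
qed

text \<open>Means of the pair (y, \<open>minorant x y\<close>) under all probability laws with a
  bounded density w with respect to the plan. Bounded densities suffice to concentrate on any set of
  positive mass.\<close>

definition tilted_means :: "((real^'n) \<times> real) set" where
  "tilted_means = {c. \<exists>w K. w \<in> borel_measurable \<gamma> \<and> (\<forall>p. 0 \<le> w p) \<and> (\<forall>p. w p \<le> K) \<and> (\<integral>p. w p \<partial>\<gamma>) = 1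
     \<and> (\<forall>i. fst c $ i = (\<integral>p. w p * snd p $ i \<partial>\<gamma>)) \<and> snd c = (\<integral>p. w p * minorant (fst p) (snd p) \<partial>\<gamma>)}"

lemma integrable_weighted:
  assumes "w \<in> borel_measurable \<gamma>" "\<And>p. 0 \<le> w p" "\<And>p. w p \<le> K"
  shows "integrable \<gamma> w" "integrable \<gamma> (\<lambda>p. w p * snd p $ i)"
    "integrable \<gamma> (\<lambda>p. w p * minorant (fst p) (snd p))"
    "integrable \<gamma> (\<lambda>p. w p * minorant x (snd p))"
proof -
  have abs: "\<bar>w p\<bar> \<le> K" for p using assms(2,3)[of p] by simp
  note b = integrable_bounded_mult[OF _ assms(1) abs]
  show "integrable \<gamma> w" using b[of "\<lambda>_. 1"] by simp
  show "integrable \<gamma> (\<lambda>p. w p * snd p $ i)"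
    by (rule b[OF square_integrable_imp_integrable[OF square_integrable_snd]])
  show "integrable \<gamma> (\<lambda>p. w p * minorant (fst p) (snd p))" by (rule b[OF integrable_minorant])
  show "integrable \<gamma> (\<lambda>p. w p * minorant x (snd p))" by (rule b[OF integrable_minorant_const(2)])
qed

lemma convex_tilted_means: "convex tilted_means"
proof (rule convexI)
  fix c d :: "(real^'n) \<times> real" and u v :: real
  assume c: "c \<in> tilted_means" and d: "d \<in> tilted_means" and uv: "0 \<le> u" "0 \<le> v" "u + v = 1"
  obtain w1 K1 where w1: "w1 \<in> borel_measurable \<gamma>" "\<And>p. 0 \<le> w1 p" "\<And>p. w1 p \<le> K1" "(\<integral>p. w1 p \<partial>\<gamma>) = 1"
    "\<And>i. fst c $ i = (\<integral>p. w1 p * snd p $ i \<partial>\<gamma>)" "snd c = (\<integral>p. w1 p * minorant (fst p) (snd p) \<partial>\<gamma>)"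
    using c by (auto simp: tilted_means_def)
  obtain w2 K2 where w2: "w2 \<in> borel_measurable \<gamma>" "\<And>p. 0 \<le> w2 p" "\<And>p. w2 p \<le> K2" "(\<integral>p. w2 p \<partial>\<gamma>) = 1"
    "\<And>i. fst d $ i = (\<integral>p. w2 p * snd p $ i \<partial>\<gamma>)" "snd d = (\<integral>p. w2 p * minorant (fst p) (snd p) \<partial>\<gamma>)"
    using d by (auto simp: tilted_means_def)
  note i1 = integrable_weighted[OF w1(1-3)]
  note i2 = integrable_weighted[OF w2(1-3)]
  define w where "w p = u * w1 p + v * w2 p" for p
  have wM: "w \<in> borel_measurable \<gamma>" unfolding w_def using w1(1) w2(1) by simp
  have w0: "0 \<le> w p" for p unfolding w_def using uv w1(2)[of p] w2(2)[of p] by simp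
  have wK: "w p \<le> u * K1 + v * K2" for p unfolding w_def
    by (intro add_mono mult_left_mono w1(3) w2(3) uv)
  have wt: "(\<integral>p. w p \<partial>\<gamma>) = 1" unfolding w_def using i1(1) i2(1) uv by (simp add: w1(4) w2(4))
  have lin: "(\<integral>p. w p * g p \<partial>\<gamma>) = u * (\<integral>p. w1 p * g p \<partial>\<gamma>) + v * (\<integral>p. w2 p * g p \<partial>\<gamma>)"
    if "integrable \<gamma> (\<lambda>p. w1 p * g p)" "integrable \<gamma> (\<lambda>p. w2 p * g p)" for g
    unfolding w_def using that by (simp add: distrib_right mult.assoc)
  show "u *\<^sub>R c + v *\<^sub>R d \<in> tilted_means"
    unfolding tilted_means_def mem_Collect_eq
  proof (intro exI[of _ w] exI[of _ "u * K1 + v * K2"] conjI allI wM w0 wK wt)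
    show "fst (u *\<^sub>R c + v *\<^sub>R d) $ i = (\<integral>p. w p * snd p $ i \<partial>\<gamma>)" for i
      by (simp add: lin[OF i1(2) i2(2)] w1(5) w2(5))
    show "snd (u *\<^sub>R c + v *\<^sub>R d) = (\<integral>p. w p * minorant (fst p) (snd p) \<partial>\<gamma>)"
      by (simp add: lin[OF i1(3) i2(3)] w1(6) w2(6))
  qed
qed

lemma above_quad_tilted_means:
  assumes "optimal_plan S \<nu> \<gamma>" shows "above_quad tilted_means"
  unfolding above_quad_def
proof (intro conjI ballI convex_tilted_means)
  fix c assume "c \<in> tilted_means"
  then obtain w K where w: "w \<in> borel_measurable \<gamma>" "\<And>p. 0 \<le> w p" "\<And>p. w p \<le> K" "(\<integral>p. w p \<partial>\<gamma>) = 1"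
    "\<And>i. fst c $ i = (\<integral>p. w p * snd p $ i \<partial>\<gamma>)" and c: "snd c = (\<integral>p. w p * minorant (fst p) (snd p) \<partial>\<gamma>)"
    by (auto simp: tilted_means_def)
  show "quad (fst c) \<le> snd c" unfolding c by (rule optimal_plan_variation[OF assms w])
qed

lemma optimal_plan_imp_duality:
  assumes opt: "optimal_plan S \<nu> \<gamma>"
  obtains G where "G \<in> maxS_monotone S" "ext_integral \<nu> (psiG S G) \<le> ereal (plan_value S \<gamma>)"
proof -
  have "((\<chi> i. \<integral>p. 1 * snd p $ i \<partial>\<gamma>), (\<integral>p. 1 * minorant (fst p) (snd p) \<partial>\<gamma>)) \<in> tilted_means"
    unfolding tilted_means_def by (intro CollectI exI[of _ "\<lambda>_. 1"] exI[of _ 1]) (simp add: prob_space[unfolded space_plan])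
  then have "tilted_means \<noteq> {}" by blast
  then obtain G where G: "G \<in> maxS_monotone S"
    and le: "\<And>x z r. x \<in> G \<Longrightarrow> (z, r) \<in> tilted_means \<Longrightarrow> minorant x z \<le> r"
    using maxS_monotone_minorant_exists[OF above_quad_tilted_means[OF opt]] by metis
  have supp: "minorant x (snd p0) \<le> minorant (fst p0) (snd p0)" if x: "x \<in> G" and p0: "p0 \<in> msupp \<gamma>" for x p0
  proof (rule ccontr)
    assume n: "\<not> minorant x (snd p0) \<le> minorant (fst p0) (snd p0)"
    \<comment> \<open>If the inequality fails at a support point, it fails on an open set U of
      positive mass. Take w uniform on U: the inequality for tilted means says that g has
      nonpositive mean there, although g is positive on U.\<close>
    define g where "g p = minorant x (snd p) - minorant (fst p) (snd p)" for p
    define U where "U = {p. 0 < g p}"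
    have "open U" unfolding U_def g_def by (intro open_Collect_less continuous_intros)
    moreover have "p0 \<in> U" using n by (simp add: U_def g_def)
    ultimately have "emeasure \<gamma> U > 0" using p0 unfolding msupp_def by blast
    then have mU: "measure \<gamma> U > 0" by (simp add: emeasure_eq_measure)
    have Us: "U \<in> sets \<gamma>" using \<open>open U\<close> sets_plan by simp
    define w where "w p = indicator U p / measure \<gamma> U" for p
    have wM: "w \<in> borel_measurable \<gamma>" unfolding w_def using Us by simp
    have w0: "0 \<le> w p" for p unfolding w_def by simp
    have wK: "w p \<le> 1 / measure \<gamma> U" for p
      unfolding w_def by (intro divide_right_mono) (simp_all add: indicator_def)
    have w1: "(\<integral>p. w p \<partial>\<gamma>) = 1" unfolding w_def using mU by simp
    note iw = integrable_weighted[OF wM w0 wK]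
    define z where "z = (\<chi> i. \<integral>p. w p * snd p $ i \<partial>\<gamma>)"
    have "(z, \<integral>p. w p * minorant (fst p) (snd p) \<partial>\<gamma>) \<in> tilted_means"
      unfolding tilted_means_def mem_Collect_eq
      by (intro exI[of _ w] exI[of _ "1 / measure \<gamma> U"] conjI allI wM w0 wK w1) (simp_all add: z_def)
    from le[OF x this] have m1: "minorant x z \<le> (\<integral>p. w p * minorant (fst p) (snd p) \<partial>\<gamma>)" .
    \<comment> \<open>\<open>minorant x\<close> is affine, so its value at the mean is the mean of
      its values; its constant part is multiplied by the total mass 1 of w.\<close>
    have "minorant x z = (\<Sum>i\<in>UNIV. (S *v x) $ i * (\<integral>p. w p * snd p $ i \<partial>\<gamma>)) - quad x * (\<integral>p. w p \<partial>\<gamma>)"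
      by (simp add: minorant_def B_component_sum z_def w1)
    also have "\<dots> = (\<integral>p. (\<Sum>i\<in>UNIV. (S *v x) $ i * (w p * snd p $ i)) - quad x * w p \<partial>\<gamma>)"
      using iw(1,2) by simp
    also have "\<dots> = (\<integral>p. w p * minorant x (snd p) \<partial>\<gamma>)"
      by (rule Bochner_Integration.integral_cong)
        (simp_all add: minorant_def B_component_sum right_diff_distrib sum_distrib_left mult_ac)
    finally have m2: "minorant x z = (\<integral>p. w p * minorant x (snd p) \<partial>\<gamma>)" .
    have ig: "integrable \<gamma> (\<lambda>p. w p * g p)"
      unfolding g_def right_diff_distrib by (intro Bochner_Integration.integrable_diff iw)
    have wg0: "0 \<le> w p * g p" for p by (simp add: w_def U_def indicator_def)
    have "(\<integral>p. w p * g p \<partial>\<gamma>) = (\<integral>p. w p * minorant x (snd p) \<partial>\<gamma>) - (\<integral>p. w p * minorant (fst p) (snd p) \<partial>\<gamma>)"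
      unfolding g_def right_diff_distrib by (intro Bochner_Integration.integral_diff iw)
    then have "(\<integral>p. w p * g p \<partial>\<gamma>) \<le> 0" using m1 m2 by simp
    moreover have "0 \<le> (\<integral>p. w p * g p \<partial>\<gamma>)" by (intro integral_nonneg_AE AE_I2 wg0)
    ultimately have "(\<integral>p. w p * g p \<partial>\<gamma>) = 0" by (rule antisym)
    then have "AE p in \<gamma>. w p * g p = 0"
      using integral_nonneg_eq_0_iff_AE[OF ig AE_I2[OF wg0]] by blast
    then have "AE p in \<gamma>. p \<notin> U"
      by eventually_elim (use mU in \<open>auto simp: w_def U_def\<close>)
    then have "emeasure \<gamma> U = 0"
      using AE_iff_measurable[of U \<gamma> "\<lambda>p. p \<notin> U"] Us by simp
    then show False using \<open>emeasure \<gamma> U > 0\<close> by simp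
  qed
  have "ext_integral \<nu> (psiG S G) \<le> ereal (\<integral>p. minorant (fst p) (snd p) \<partial>\<gamma>)"
    unfolding ext_integral_second_marginal[OF maxS_monotone_nonempty[OF G]]
  proof (rule ext_integral_le[OF integrable_minorant])
    show "AE p in \<gamma>. psiG S G (snd p) \<le> ereal (minorant (fst p) (snd p))"
      using AE_mem_msupp[OF sets_plan] by eventually_elim (simp add: psiG_le_iff supp)
  qed
  then show ?thesis using that G by (simp add: integral_minorant)
qed

text \<open>The zero-gap set G' may differ from G, but an optimal G has no larger dual value, so
  slackness holds for G too.\<close>

lemma optimal_imp_PG:
  assumes plan: "optimal_plan S \<nu> \<gamma>" and set: "optimal_set S \<nu> G"
  shows "AE p in \<gamma>. fst p \<in> PG S G (snd p)"
proof -
  obtain G' where G': "G' \<in> maxS_monotone S" "ext_integral \<nu> (psiG S G') \<le> ereal (plan_value S \<gamma>)"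
    by (rule optimal_plan_imp_duality[OF plan])
  have G: "G \<in> maxS_monotone S" and "ext_integral \<nu> (psiG S G) \<le> ext_integral \<nu> (psiG S G')"
    using set G'(1) unfolding optimal_set_def by blast+
  then show ?thesis using G'(2) by (intro PG_of_duality order_trans[OF _ G'(2)])
qed

end

context nondegenerate_form begin

section \<open>Selections of the argmax set\<close>

lemma closed_PG:
  assumes "closed G" shows "closed (PG S G y)"
proof -
  have "closed ((\<lambda>x. (x, y)) -` {p. fst p \<in> PG S G (snd p)})"
    by (intro closed_vimage closed_graph_PG assms continuous_intros)
  then show ?thesis by (simp add: vimage_def)
qed

text \<open>The projection of a closed graph along a compact factor is closed. Compactness of K thus
  settles measurability of the hitting event.\<close>

lemma closed_PG_hits:
  assumes "closed G" "compact K" shows "closed {y. PG S G y \<inter> K \<noteq> {}}"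
proof -
  have "{y. PG S G y \<inter> K \<noteq> {}} = {y. \<exists>x. x \<in> K \<and> (x, y) \<in> {p. fst p \<in> PG S G (snd p)}}"
    by auto
  then show ?thesis using closed_compact_projection[OF assms(2) closed_graph_PG[OF assms(1)]] by simp
qed

text \<open>The first point of a dense sequence within delta of the argmax set in K is a measurable
  function of y, since each candidate index is tested by a closed condition. Such a point may lie
  outside G, so its error has to be tracked.\<close>

lemma approximate_selection_exists:
  assumes G: "closed G" and K: "compact K" and \<delta>: "0 < \<delta>"
  obtains \<sigma> where "\<sigma> \<in> borel_measurable borel"
    "\<And>y. PG S G y \<inter> K \<noteq> {} \<Longrightarrow> \<exists>x\<in>PG S G y \<inter> K. dist (\<sigma> y) x \<le> \<delta>"
proof -
  obtain q :: "nat \<Rightarrow> real^'n" where q: "range q \<subseteq> UNIV" "UNIV \<subseteq> closure (range q)"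
    by (rule dense_sequence[of "UNIV :: (real^'n) set"]) simp
  define P where "P k y \<longleftrightarrow> PG S G y \<inter> (K \<inter> cball (q k) \<delta>) \<noteq> {}" for k y
  define \<sigma> where "\<sigma> y = q (LEAST k. P k y)" for y
  have "Measurable.pred borel (P k)" for k
  proof -
    have "closed {y. P k y}" unfolding P_def by (intro closed_PG_hits G compact_Int_closed K closed_cball)
    then have "{y \<in> space borel. P k y} \<in> sets borel" by simp
    then show ?thesis unfolding pred_def .
  qed
  then have "(\<lambda>y. LEAST k. P k y) \<in> measurable borel (count_space UNIV)" by (intro measurable_Least) auto
  then have "\<sigma> \<in> borel_measurable borel" unfolding \<sigma>_def by (rule measurable_compose) simp
  moreover have "\<exists>x\<in>PG S G y \<inter> K. dist (\<sigma> y) x \<le> \<delta>" if hit: "PG S G y \<inter> K \<noteq> {}" for y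
  proof -
    obtain x where x: "x \<in> PG S G y" "x \<in> K" using hit by auto
    have "x \<in> closure (range q)" using q(2) by auto
    then obtain k where k: "dist (q k) x < \<delta>" using \<delta> unfolding closure_approachable by auto
    then have "P k y" using x by (auto simp: P_def)
    then have "P (LEAST k. P k y) y" by (rule LeastI)
    then show ?thesis by (auto simp: P_def \<sigma>_def)
  qed
  ultimately show ?thesis using that by simp
qed

lemma minorant_lipschitz:
  obtains L where "0 \<le> L"
    "\<And>x x' y \<delta>. norm x \<le> R \<Longrightarrow> dist x' x \<le> \<delta> \<Longrightarrow> \<delta> \<le> 1 \<Longrightarrow> \<bar>minorant x y - minorant x' y\<bar> \<le> L * \<delta> * (1 + norm y)"
proof -
  obtain C where C0: "C > 0" and C: "\<And>x y. \<bar>B x y\<bar> \<le> C * norm x * norm y" using B_bound by blast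
  define L where "L = C * (2 * \<bar>R\<bar> + 2)"
  have "\<bar>minorant x y - minorant x' y\<bar> \<le> L * \<delta> * (1 + norm y)"
    if x: "norm x \<le> R" and d: "dist x' x \<le> \<delta>" "\<delta> \<le> 1" for x x' y and \<delta> :: real
  proof -
    have n: "norm (x - x') \<le> \<delta>" using d(1) by (simp add: dist_norm norm_minus_commute)
    have d0: "0 \<le> \<delta>" using n norm_ge_zero order_trans by blast
    have "norm x' \<le> norm x + norm (x - x')" by (rule norm_triangle_sub[of x' x, unfolded norm_minus_commute[of x' x]])
    then have s: "norm (2 *\<^sub>R y - (x + x')) \<le> 2 * norm y + (2 * \<bar>R\<bar> + 1)"
      using norm_triangle_ineq4[of "2 *\<^sub>R y" "x + x'"] norm_triangle_ineq[of x x'] x n d(2) by simp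
    \<comment> \<open>A difference of squares factors through x - x', which gives the Lipschitz
      estimate with the growth \<open>1 + norm y\<close>.\<close>
    have "minorant x y - minorant x' y = B (x - x') (2 *\<^sub>R y - (x + x')) / 2"
      by (simp add: minorant_def quad_def B_simps B_commute[of x' x] field_simps)
    then have "\<bar>minorant x y - minorant x' y\<bar> = \<bar>B (x - x') (2 *\<^sub>R y - (x + x'))\<bar> / 2"
      by (simp only: abs_divide abs_numeral)
    also have "\<dots> \<le> (C * norm (x - x') * norm (2 *\<^sub>R y - (x + x'))) / 2" by (intro divide_right_mono C) simp
    also have "\<dots> \<le> (C * \<delta> * (2 * norm y + (2 * \<bar>R\<bar> + 1))) / 2"
      using C0 d0 by (intro divide_right_mono mult_mono s n) auto
    also have "\<dots> \<le> L * \<delta> * (1 + norm y)"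
    proof -
      have "(2 * norm y + (2 * \<bar>R\<bar> + 1)) / 2 \<le> (2 * \<bar>R\<bar> + 2) * (1 + norm y)"
        using mult_nonneg_nonneg[OF abs_ge_zero[of R] norm_ge_zero[of y]] by (simp add: algebra_simps)
      from mult_left_mono[OF this, of "C * \<delta>"] show ?thesis using C0 d0 by (simp add: L_def mult_ac)
    qed
    finally show ?thesis .
  qed
  moreover have "0 \<le> L" using C0 by (simp add: L_def)
  ultimately show ?thesis using that by blast
qed

end

section \<open>Inclusion of argmax sets\<close>

context form_plan begin

text \<open>The martingale property tested against a nearly exact selection \<open>\<sigma>\<close> of \<open>PG S G x \<inter> K\<close>
  shows that \<open>\<sigma> x\<close> is nearly optimal for \<open>y\<close> as well.\<close>

lemma PG_hit_optimal:
  assumes G: "G \<in> maxS_monotone S" and PG: "AE p in \<gamma>. fst p \<in> PG S G (snd p)"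
    and K: "compact K"
  shows "AE p in \<gamma>. PG S G (fst p) \<inter> K \<noteq> {} \<longrightarrow>
    (\<exists>x\<in>PG S G (fst p) \<inter> K. minorant (fst p) (snd p) \<le> minorant x (snd p))"
proof -
  note clG = closed_maxS_monotone[OF G]
  obtain R where R: "\<And>x. x \<in> K \<Longrightarrow> norm x \<le> R" using compact_imp_bounded[OF K] by (auto simp: bounded_iff)
  obtain L where L0: "0 \<le> L" and L: "\<And>x x' y \<delta>. norm x \<le> R \<Longrightarrow> dist x' x \<le> \<delta> \<Longrightarrow> \<delta> \<le> 1 \<Longrightarrow>
      \<bar>minorant x y - minorant x' y\<bar> \<le> L * \<delta> * (1 + norm y)"
    by (rule minorant_lipschitz[of R]) (erule that, blast)
  define C where "C = {y. PG S G y \<inter> K \<noteq> {}}"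
  have C: "C \<in> sets borel" unfolding C_def using closed_PG_hits[OF clG K] by simp
  define \<epsilon> where "\<epsilon> n = inverse (real (Suc n))" for n
  have \<epsilon>: "0 < \<epsilon> n" "\<epsilon> n \<le> 1" for n by (simp_all add: \<epsilon>_def inverse_eq_divide)
  have "\<exists>\<sigma>. \<sigma> \<in> borel_measurable borel \<and>
      (\<forall>y. PG S G y \<inter> K \<noteq> {} \<longrightarrow> (\<exists>x\<in>PG S G y \<inter> K. dist (\<sigma> y) x \<le> \<epsilon> n))" for n
    by (rule approximate_selection_exists[OF clG K \<epsilon>(1)[of n]]) blast
  then obtain \<sigma> where \<sigma>: "\<And>n. \<sigma> n \<in> borel_measurable borel"
    "\<And>n y. PG S G y \<inter> K \<noteq> {} \<Longrightarrow> \<exists>x\<in>PG S G y \<inter> K. dist (\<sigma> n y) x \<le> \<epsilon> n" by metis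
  \<comment> \<open>Where the argmax set misses K the point itself is chosen; there the comparison
    with \<open>quad\<close> is exact and the growth is linear.\<close>
  define \<tau> where "\<tau> n y = (if y \<in> C then \<sigma> n y else y)" for n y
  have \<tau>M: "\<tau> n \<in> borel_measurable borel" for n
    unfolding \<tau>_def using C \<sigma>(1) by (intro measurable_If) simp_all
  have \<tau>b: "\<bar>\<tau> n y $ i\<bar> \<le> (\<bar>R\<bar> + 1) + \<bar>y $ i\<bar>" for n y i
  proof (cases "y \<in> C")
    case True
    then obtain x where x: "x \<in> K" "dist (\<sigma> n y) x \<le> \<epsilon> n" using \<sigma>(2)[of y n] by (auto simp: C_def)
    have "norm (\<sigma> n y) \<le> norm x + dist (\<sigma> n y) x" by (simp add: dist_norm norm_triangle_sub)
    then have "norm (\<sigma> n y) \<le> \<bar>R\<bar> + 1" using R[OF x(1)] x(2) \<epsilon>(2)[of n] by simp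
    then show ?thesis using True component_le_norm_cart[of "\<sigma> n y" i] by (simp add: \<tau>_def)
  qed (simp add: \<tau>_def)
  have \<tau>F: "(\<lambda>p. \<tau> n (fst p)) \<in> borel_measurable F" for n by (rule fst_comp_measurable_F[OF \<tau>M])
  have \<tau>2: "square_integrable \<gamma> (\<lambda>p. \<tau> n (fst p) $ i)" for n i
  proof -
    have m: "(\<lambda>p. \<tau> n (fst p) $ i) \<in> borel_measurable F"
      by (rule measurable_compose[OF \<tau>F]) (intro borel_measurable_continuous_onI continuous_intros)
    have "square_integrable \<gamma> (\<lambda>p. (\<bar>R\<bar> + 1) + \<bar>fst p $ i\<bar>)"
    proof (rule square_integrable_add)
      show "square_integrable \<gamma> (\<lambda>p. \<bar>fst p $ i\<bar>)"
        using square_integrable_fst[of i] by (auto simp: square_integrable_def)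
    qed (simp add: square_integrable_def)
    then have b: "integrable \<gamma> (\<lambda>p. ((\<bar>R\<bar> + 1) + \<bar>fst p $ i\<bar>)\<^sup>2)" by (simp add: square_integrable_def)
    have "integrable \<gamma> (\<lambda>p. (\<tau> n (fst p) $ i)\<^sup>2)"
    proof (rule Bochner_Integration.integrable_bound[OF b])
      show "(\<lambda>p. (\<tau> n (fst p) $ i)\<^sup>2) \<in> borel_measurable \<gamma>"
        using measurable_from_subalg[OF subalg m] by simp
      show "AE p in \<gamma>. norm ((\<tau> n (fst p) $ i)\<^sup>2) \<le> norm (((\<bar>R\<bar> + 1) + \<bar>fst p $ i\<bar>)\<^sup>2)"
      proof (rule AE_I2)
        fix p :: "(real^'n) \<times> (real^'n)"
        show "norm ((\<tau> n (fst p) $ i)\<^sup>2) \<le> norm (((\<bar>R\<bar> + 1) + \<bar>fst p $ i\<bar>)\<^sup>2)"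
          using power_mono[OF \<tau>b[of n "fst p" i] abs_ge_zero, of 2] by simp
      qed
    qed
    then show ?thesis using measurable_from_subalg[OF subalg m] by (simp add: square_integrable_def)
  qed
  note test = square_integrable_test[OF \<tau>F \<tau>2]
  have normM: "(\<lambda>p. norm (fst p)) \<in> borel_measurable \<gamma>" "(\<lambda>p. norm (snd p)) \<in> borel_measurable \<gamma>"
    by (intro continuous_measurable_plan continuous_intros)+
  have normI: "integrable \<gamma> (\<lambda>p. norm (fst p))" "integrable \<gamma> (\<lambda>p. norm (snd p))"
  proof -
    have "\<bar>norm (fst p)\<bar> \<le> 1 * norm p" "\<bar>norm (snd p)\<bar> \<le> 1 * norm p" for p :: "(real^'n) \<times> (real^'n)"
      using norm_fst_le[of "fst p" "snd p"] norm_snd_le[of "snd p" "fst p"] by simp_all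
    note b = this
    show "integrable \<gamma> (\<lambda>p. norm (fst p))"
      by (rule square_integrable_imp_integrable[OF square_integrable_linear[OF normM(1) b(1)]])
    show "integrable \<gamma> (\<lambda>p. norm (snd p))"
      by (rule square_integrable_imp_integrable[OF square_integrable_linear[OF normM(2) b(2)]])
  qed
  \<comment> \<open>The last summand pays for the selection leaving G, so that e is almost surely
    nonnegative and its mean controls its L1 norm.\<close>
  define e where "e n p = minorant (fst p) (snd p) - minorant (\<tau> n (fst p)) (snd p) + L * \<epsilon> n * (1 + norm (snd p))" for n p
  have eI: "integrable \<gamma> (e n)" for n
    unfolding e_def using integrable_minorant test(2)[of n] normI(2) by simp
  have near: "\<exists>x\<in>PG S G y \<inter> K. \<forall>z. \<bar>minorant x z - minorant (\<tau> n y) z\<bar> \<le> L * \<epsilon> n * (1 + norm z)"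
    if "y \<in> C" for n y
  proof -
    obtain x where x: "x \<in> PG S G y \<inter> K" "dist (\<sigma> n y) x \<le> \<epsilon> n"
      using \<sigma>(2)[of y n] \<open>y \<in> C\<close> by (auto simp: C_def)
    have "\<bar>minorant x z - minorant (\<tau> n y) z\<bar> \<le> L * \<epsilon> n * (1 + norm z)" for z
      using L[OF R x(2) \<epsilon>(2), of z] x(1) \<open>y \<in> C\<close> by (simp add: \<tau>_def)
    then show ?thesis using x(1) by blast
  qed
  have e0: "AE p in \<gamma>. 0 \<le> e n p" for n
    using PG
  proof eventually_elim
    fix p :: "(real^'n) \<times> (real^'n)" assume p: "fst p \<in> PG S G (snd p)"
    show "0 \<le> e n p"
    proof (cases "fst p \<in> C")
      case True
      then obtain x where x: "x \<in> PG S G (fst p)"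
        "\<bar>minorant x (snd p) - minorant (\<tau> n (fst p)) (snd p)\<bar> \<le> L * \<epsilon> n * (1 + norm (snd p))"
        using near by blast
      have "minorant x (snd p) \<le> minorant (fst p) (snd p)" using p x(1) by (simp add: PG_eq)
      then show ?thesis using x(2) by (simp add: e_def abs_le_iff)
    next
      case False
      then show ?thesis using L0 \<epsilon>(1)[of n] by (simp add: e_def \<tau>_def add_nonneg_nonneg)
    qed
  qed
  define M where "M = L * (\<integral>p. 2 + norm (fst p) + norm (snd p) \<partial>\<gamma>)"
  have e_le: "(\<integral>p. norm (e n p) \<partial>\<gamma>) \<le> \<epsilon> n * M" for n
  proof -
    have "(\<integral>p. norm (e n p) \<partial>\<gamma>) = (\<integral>p. e n p \<partial>\<gamma>)"
      using eI[of n] e0[of n] by (intro integral_cong_AE) (auto dest: borel_measurable_integrable)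
    also have "\<dots> = (\<integral>p. minorant (fst p) (snd p) \<partial>\<gamma>) - (\<integral>p. minorant (\<tau> n (fst p)) (snd p) \<partial>\<gamma>)
        + (\<integral>p. L * \<epsilon> n * (1 + norm (snd p)) \<partial>\<gamma>)"
      unfolding e_def using integrable_minorant test(2)[of n] normI(2) by simp
    \<comment> \<open>The decisive exchange: the selection depends on x only, so y may be replaced
      by x under the integral, and at x the selection is optimal up to an error of order
      epsilon.\<close>
    also have "\<dots> = (\<integral>p. quad (fst p) - minorant (\<tau> n (fst p)) (fst p) + L * \<epsilon> n * (1 + norm (snd p)) \<partial>\<gamma>)"
      using integrable_quad_fst test(1)[of n] normI(2)
      by (simp add: integral_minorant plan_value_eq test(3))
    also have "\<dots> \<le> (\<integral>p. \<epsilon> n * (L * (2 + norm (fst p) + norm (snd p))) \<partial>\<gamma>)"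
    proof (rule integral_mono_AE)
      show "AE p in \<gamma>. quad (fst p) - minorant (\<tau> n (fst p)) (fst p) + L * \<epsilon> n * (1 + norm (snd p))
          \<le> \<epsilon> n * (L * (2 + norm (fst p) + norm (snd p)))"
        using PG
      proof eventually_elim
        fix p :: "(real^'n) \<times> (real^'n)" assume p: "fst p \<in> PG S G (snd p)"
        then have X: "fst p \<in> G" by (simp add: PG_eq)
        have "quad (fst p) - minorant (\<tau> n (fst p)) (fst p) \<le> L * \<epsilon> n * (1 + norm (fst p))"
        proof (cases "fst p \<in> C")
          case True
          then obtain x where x: "x \<in> PG S G (fst p)"
            "\<bar>minorant x (fst p) - minorant (\<tau> n (fst p)) (fst p)\<bar> \<le> L * \<epsilon> n * (1 + norm (fst p))"
            using near by blast
          have "minorant (fst p) (fst p) \<le> minorant x (fst p)" using X x(1) unfolding PG_eq by blast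
          then show ?thesis using x(2) by (simp add: abs_le_iff)
        next
          case False
          then show ?thesis using L0 \<epsilon>(1)[of n] by (simp add: \<tau>_def)
        qed
        then show "quad (fst p) - minorant (\<tau> n (fst p)) (fst p) + L * \<epsilon> n * (1 + norm (snd p))
          \<le> \<epsilon> n * (L * (2 + norm (fst p) + norm (snd p)))"
          by (simp add: algebra_simps)
      qed
    qed (use integrable_quad_fst test(1)[of n] normI in simp_all)
    also have "\<dots> = \<epsilon> n * M" unfolding M_def by simp
    finally show ?thesis .
  qed
  have "(\<lambda>n. \<integral>p. norm (e n p) \<partial>\<gamma>) \<longlonglongrightarrow> 0"
  proof (rule real_tendsto_sandwich)
    show "\<forall>\<^sub>F n in sequentially. 0 \<le> (\<integral>p. norm (e n p) \<partial>\<gamma>)" by simp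
    show "\<forall>\<^sub>F n in sequentially. (\<integral>p. norm (e n p) \<partial>\<gamma>) \<le> \<epsilon> n * M" using e_le by simp
    have "\<epsilon> \<longlonglongrightarrow> 0" unfolding \<epsilon>_def by (rule LIMSEQ_inverse_real_of_nat)
    then have "(\<lambda>n. \<epsilon> n * M) \<longlonglongrightarrow> 0 * M" by (intro tendsto_mult tendsto_const)
    then show "(\<lambda>n. \<epsilon> n * M) \<longlonglongrightarrow> 0" by simp
  qed simp
  then obtain r where r: "AE p in \<gamma>. (\<lambda>n. e (r n) p) \<longlonglongrightarrow> 0"
    using tendsto_L1_AE_subseq[where u=e, OF eI] by auto
  then show ?thesis
  proof eventually_elim
    fix p :: "(real^'n) \<times> (real^'n)" assume lim: "(\<lambda>n. e (r n) p) \<longlonglongrightarrow> 0"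
    show "PG S G (fst p) \<inter> K \<noteq> {} \<longrightarrow>
      (\<exists>x\<in>PG S G (fst p) \<inter> K. minorant (fst p) (snd p) \<le> minorant x (snd p))"
    proof
      assume hit: "PG S G (fst p) \<inter> K \<noteq> {}"
      have "compact (PG S G (fst p) \<inter> K)" by (rule closed_Int_compact[OF closed_PG[OF clG] K])
      moreover have "continuous_on (PG S G (fst p) \<inter> K) (\<lambda>x. minorant x (snd p))" by (intro continuous_intros)
      ultimately obtain x where x: "x \<in> PG S G (fst p) \<inter> K"
        and xmax: "\<And>x'. x' \<in> PG S G (fst p) \<inter> K \<Longrightarrow> minorant x' (snd p) \<le> minorant x (snd p)"
        using continuous_attains_sup[of "PG S G (fst p) \<inter> K" "\<lambda>x. minorant x (snd p)"] hit by blast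
      \<comment> \<open>An exact maximizer over the compact set does at least as well as every
        nearby point of the approximate selections, so one x serves all n.\<close>
      have le: "minorant (fst p) (snd p) - e n p \<le> minorant x (snd p)" for n
      proof -
        obtain x' where "x' \<in> PG S G (fst p) \<inter> K"
          "\<bar>minorant x' (snd p) - minorant (\<tau> n (fst p)) (snd p)\<bar> \<le> L * \<epsilon> n * (1 + norm (snd p))"
          using near[of "fst p" n] hit by (auto simp: C_def)
        then show ?thesis using xmax[of x'] by (simp add: e_def abs_le_iff)
      qed
      have "(\<lambda>n. minorant (fst p) (snd p) - e (r n) p) \<longlonglongrightarrow> minorant (fst p) (snd p) - 0"
        by (intro tendsto_diff tendsto_const lim)
      then have "minorant (fst p) (snd p) - 0 \<le> minorant x (snd p)"
        by (rule LIMSEQ_le_const2) (intro exI[of _ 0] allI impI le)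
      then show "\<exists>x\<in>PG S G (fst p) \<inter> K. minorant (fst p) (snd p) \<le> minorant x (snd p)" using x by auto
    qed
  qed
qed

text \<open>Taking for K small balls about a dense sequence, each point of
  \<open>PG S G (fst p)\<close> becomes a limit of points at least as good for y as x itself. The
  set of such points is closed, and x is already optimal for y.\<close>

lemma PG_imp_PG_subset:
  assumes G: "G \<in> maxS_monotone S" and PG: "AE p in \<gamma>. fst p \<in> PG S G (snd p)"
  shows "AE p in \<gamma>. fst p \<in> PG S G (fst p) \<and> PG S G (fst p) \<subseteq> PG S G (snd p)"
proof -
  obtain q :: "nat \<Rightarrow> real^'n" where q: "range q \<subseteq> UNIV" "UNIV \<subseteq> closure (range q)"
    by (rule dense_sequence[of "UNIV :: (real^'n) set"]) simp
  let ?K = "\<lambda>k m. cball (q k) (inverse (real (Suc m)))"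
  have "AE p in \<gamma>. \<forall>k m. PG S G (fst p) \<inter> ?K k m \<noteq> {} \<longrightarrow>
    (\<exists>x\<in>PG S G (fst p) \<inter> ?K k m. minorant (fst p) (snd p) \<le> minorant x (snd p))"
    unfolding AE_all_countable by (intro allI PG_hit_optimal G PG compact_cball)
  with PG show ?thesis
  proof eventually_elim
    fix p :: "(real^'n) \<times> (real^'n)"
    assume p: "fst p \<in> PG S G (snd p)" and hit: "\<forall>k m. PG S G (fst p) \<inter> ?K k m \<noteq> {} \<longrightarrow>
      (\<exists>x\<in>PG S G (fst p) \<inter> ?K k m. minorant (fst p) (snd p) \<le> minorant x (snd p))"
    have "x \<in> PG S G (snd p)" if x: "x \<in> PG S G (fst p)" for x
    proof -
      let ?A = "{x. minorant (fst p) (snd p) \<le> minorant x (snd p)}"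
      have "closed ?A" by (intro closed_Collect_le continuous_intros)
      moreover have "x \<in> closure ?A"
        unfolding closure_approachable
      proof (intro allI impI)
        fix e :: real assume "0 < e"
        then obtain m where m: "inverse (real (Suc m)) < e / 2"
          using reals_Archimedean[of "e / 2"] by auto
        have "x \<in> closure (range q)" using q(2) by auto
        moreover have "0 < inverse (real (Suc m))" by simp
        ultimately obtain k where k: "dist (q k) x < inverse (real (Suc m))"
          using closure_approachable[of x "range q"] by blast
        then have "x \<in> PG S G (fst p) \<inter> ?K k m" using x by simp
        then obtain x' where x': "x' \<in> ?K k m" "x' \<in> ?A" using hit by blast
        have "dist x' x \<le> dist x' (q k) + dist (q k) x" by (rule dist_triangle)
        then have "dist x' x < e" using x'(1) k m by (simp add: dist_commute)
        then show "\<exists>y\<in>?A. dist y x < e" using x'(2) by blast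
      qed
      ultimately have "x \<in> ?A" by simp
      then have le: "minorant (fst p) (snd p) \<le> minorant x (snd p)" by simp
      have xG: "x \<in> G" using x unfolding PG_eq by blast
      show ?thesis using p xG order_trans[OF _ le] unfolding PG_eq by blast
    qed
    moreover have "fst p \<in> G" using p unfolding PG_eq by blast
    ultimately show "fst p \<in> PG S G (fst p) \<and> PG S G (fst p) \<subseteq> PG S G (snd p)"
      using mem_PG_self[OF G] by blast
  qed
qed

end

theorem theorem2:
  fixes S :: "real^'n^'n" and m :: nat
    and \<nu> :: "(real^'n) measure"
    and \<gamma> :: "((real^'n) \<times> (real^'n)) measure"
    and G :: "(real^'n) set"
  assumes "S \<in> Sdm m"
    and "prob_space \<nu>" and "sets \<nu> = sets borel"
    and "integrable \<nu> (\<lambda>y. norm y ^ 2)"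
    and "\<gamma> \<in> Gamma \<nu>"
    and "G \<in> maxS_monotone S"
  shows "((optimal_plan S \<nu> \<gamma> \<and> optimal_set S \<nu> G)
            \<longleftrightarrow> (\<forall>(x, y)\<in>msupp \<gamma>. x \<in> PG S G y))
       \<and> ((\<forall>(x, y)\<in>msupp \<gamma>. x \<in> PG S G y)
            \<longleftrightarrow> (AE p in \<gamma>. fst p \<in> PG S G (fst p) \<and> PG S G (fst p) \<subseteq> PG S G (snd p)))"
proof -
  have sym: "nondegenerate_form S"
    using assms(1) by unfold_locales (simp_all add: Sdm_def)
  interpret form_plan S \<nu> \<gamma>
    by (intro form_plan.intro sym martingale_plan.intro assms(5))
  \<comment> \<open>All three conditions are compared with almost sure membership of x in the argmax
    set of y.\<close>
  note supp = PG_supp_iff_AE[OF closed_maxS_monotone[OF assms(6)]]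
  have "(optimal_plan S \<nu> \<gamma> \<and> optimal_set S \<nu> G) \<longleftrightarrow> (AE p in \<gamma>. fst p \<in> PG S G (snd p))"
    using PG_imp_optimal[OF assms(6)] optimal_imp_PG by blast
  moreover have "AE p in \<gamma>. fst p \<in> PG S G (snd p)"
    if "AE p in \<gamma>. fst p \<in> PG S G (fst p) \<and> PG S G (fst p) \<subseteq> PG S G (snd p)"
    using that by eventually_elim blast
  then have "(AE p in \<gamma>. fst p \<in> PG S G (snd p)) \<longleftrightarrow>
      (AE p in \<gamma>. fst p \<in> PG S G (fst p) \<and> PG S G (fst p) \<subseteq> PG S G (snd p))"
    using PG_imp_PG_subset[OF assms(6)] by blast
  ultimately show ?thesis unfolding supp by (rule conjI)
qed

end
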